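(* For positive integers $\ell$ and $q\ge 2$, there is an $\widetilde{O}(2^\ell q^2)$-time algorithm that solves the average-case modular $2^\ell$-SUM problem over $\mathbb{Z}_{q^\ell}$ with $m$ elements, for some $m=\widetilde{\Theta}(2^\ell q^2)$.
   Context: For integers $m,k\ge 2$ and modulus $Q\ge 2$, the average-case modular $k$-SUM problem over $\mathbb{Z}_Q$ with $m$ elements is the search problem: the input is $a_1,\ldots,a_m$ chosen independently and uniformly from $\mathbb{Z}_Q$, and the goal is to find $k$ distinct indices $i_1,\ldots,i_k$ with $a_{i_1}+\cdots+a_{i_k}\equiv 0\pmod Q$. "Solves" means it outputs such a solution with (at least constant) probability over the random input. $\widetilde{O},\widetilde{\Theta}$ hide polylogarithmic factors. *)

theory Defs
  imports "HOL-Probability.Probability" "HOL-Library.Landau_Symbols" "HOL-Library.Log_Nat"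
    "HOL-Number_Theory.Cong"
begin

section \<open>Random access machine with logarithmic cost\<close>

text \<open>
  Deterministic programs over a finite set of registers and an unbounded memory, all holding
  natural numbers and initially zero apart from the input. Time is charged by the logarithmic cost
  criterion: every operation pays for the bit length of the addresses and values involved, and
  multiplication and division pay the schoolbook product of the lengths. Hence no word size has to
  be fixed, and a program of cost \<open>T\<close> takes time \<open>T\<close> up to polylogarithmic
  factors in the usual RAM and word-RAM models.
\<close>

datatype binop = Add | Sub | Mul | Div | Mod

datatype expr =
    Const nat
  | Reg nat
  | Load expr
  | Op binop expr expr

datatype prog =
    Skip
  | SetReg nat expr
  | Store expr expr \<comment> \<open>address, value\<close>
  | Seq prog prog
  | Cond expr prog prog \<comment> \<open>a test succeeds iff its value is nonzero\<close>
  | While expr prog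

type_synonym state = "(nat \<Rightarrow> nat) \<times> (nat \<Rightarrow> nat)" \<comment> \<open>registers, memory\<close>

definition len :: "nat \<Rightarrow> nat" where
  "len n = max 1 (floorlog 2 n)"

fun op_val :: "binop \<Rightarrow> nat \<Rightarrow> nat \<Rightarrow> nat" where
  "op_val Add x y = x + y"
| "op_val Sub x y = x - y"
| "op_val Mul x y = x * y"
| "op_val Div x y = x div y"
| "op_val Mod x y = x mod y"

fun op_cost :: "binop \<Rightarrow> nat \<Rightarrow> nat \<Rightarrow> nat" where
  "op_cost Add x y = len x + len y"
| "op_cost Sub x y = len x + len y"
| "op_cost Mul x y = len x * len y"
| "op_cost Div x y = len x * len y"
| "op_cost Mod x y = len x * len y"

fun val :: "expr \<Rightarrow> state \<Rightarrow> nat" where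
  "val (Const n) s = n"
| "val (Reg r) s = fst s r"
| "val (Load e) s = snd s (val e s)"
| "val (Op b e1 e2) s = op_val b (val e1 s) (val e2 s)"

fun cost :: "expr \<Rightarrow> state \<Rightarrow> nat" where
  "cost (Const n) s = len n"
| "cost (Reg r) s = len r + len (fst s r)"
| "cost (Load e) s = cost e s + len (val e s) + len (snd s (val e s))"
| "cost (Op b e1 e2) s = cost e1 s + cost e2 s + op_cost b (val e1 s) (val e2 s)"

text \<open>\<open>exec P s t s'\<close>: started in \<open>s\<close>, the program \<open>P\<close>
  halts in state \<open>s'\<close> after time \<open>t\<close>.\<close>

inductive exec :: "prog \<Rightarrow> state \<Rightarrow> nat \<Rightarrow> state \<Rightarrow> bool" where
  Skip: "exec Skip s 1 s"
| SetReg: "exec (SetReg r e) s (cost e s + len r + len (val e s))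
             ((fst s)(r := val e s), snd s)"
| Store: "exec (Store e1 e2) s (cost e1 s + cost e2 s + len (val e1 s) + len (val e2 s))
            (fst s, (snd s)(val e1 s := val e2 s))"
| Seq: "exec P1 s1 t1 s2 \<Longrightarrow> exec P2 s2 t2 s3 \<Longrightarrow> exec (Seq P1 P2) s1 (t1 + t2) s3"
| CondTrue: "val e s \<noteq> 0 \<Longrightarrow> exec P1 s t s' \<Longrightarrow> exec (Cond e P1 P2) s (cost e s + t) s'"
| CondFalse: "val e s = 0 \<Longrightarrow> exec P2 s t s' \<Longrightarrow> exec (Cond e P1 P2) s (cost e s + t) s'"
| WhileFalse: "val e s = 0 \<Longrightarrow> exec (While e P) s (cost e s) s"
| WhileTrue: "val e s1 \<noteq> 0 \<Longrightarrow> exec P s1 t1 s2 \<Longrightarrow> exec (While e P) s2 t2 s3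
    \<Longrightarrow> exec (While e P) s1 (cost e s1 + t1 + t2) s3"

inductive_cases exec_elims:
  "exec Skip s t s'" "exec (SetReg r e) s t s'" "exec (Store e1 e2) s t s'"
  "exec (Seq P1 P2) s t s'" "exec (Cond e P1 P2) s t s'"

inductive_cases exec_While_elim: "exec (While e P) s t s'"

lemma exec_deterministic:
  "exec P s t1 s1 \<Longrightarrow> exec P s t2 s2 \<Longrightarrow> t1 = t2 \<and> s1 = s2"
proof (induction arbitrary: t2 s2 rule: exec.induct)
  case (Seq P1 s1 t1 s2' P2 t2' s3)
  from Seq.prems show ?case
    by (rule exec_elims(4)) (metis Seq.IH)
next
  case (CondTrue e s P1 t s' P2)
  from CondTrue.prems show ?case
    by (rule exec_elims(5)) (use CondTrue.hyps(1) in \<open>auto dest: CondTrue.IH\<close>)+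
next
  case (CondFalse e s P2 t s' P1)
  from CondFalse.prems show ?case
    by (rule exec_elims(5)) (use CondFalse.hyps(1) in \<open>auto dest: CondFalse.IH\<close>)+
next
  case (WhileTrue e s1 P t1 s2' t2' s3)
  from WhileTrue.prems show ?case
    by (rule exec_While_elim) (metis WhileTrue.IH WhileTrue.hyps(1))+
next
  case (WhileFalse e s P)
  from WhileFalse.prems show ?case
    by (rule exec_While_elim) (use WhileFalse.hyps in simp)+
qed (erule exec_elims(1-3), simp)+


section \<open>Average-case modular k-SUM\<close>

text \<open>
  Elements of \<open>\<int>\<^sub>Q\<close> are represented by \<open>{..<Q}\<close>, indices by \<open>{..<m}\<close>; an instance is extended by
  zero outside \<open>{..<m}\<close>, so that it can serve directly as the initial memory.
\<close>

definition ksum_instances :: "nat \<Rightarrow> nat \<Rightarrow> (nat \<Rightarrow> nat) set" where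
  "ksum_instances m Q = PiE_dflt {..<m} 0 (\<lambda>_. {..<Q})"

definition ksum_dist :: "nat \<Rightarrow> nat \<Rightarrow> (nat \<Rightarrow> nat) pmf" where
  "ksum_dist m Q = Pi_pmf {..<m} 0 (\<lambda>_. pmf_of_set {..<Q})"

definition ksum_solution :: "nat \<Rightarrow> nat \<Rightarrow> nat \<Rightarrow> (nat \<Rightarrow> nat) \<Rightarrow> nat list \<Rightarrow> bool" where
  "ksum_solution k Q m a is \<longleftrightarrow>
     length is = k \<and> distinct is \<and> set is \<subseteq> {..<m} \<and> [(\<Sum>i\<leftarrow>is. a i) = 0] (mod Q)"

text \<open>Scalar parameters are passed in the first registers; the output is read from
  the first memory cells.\<close>

definition input_state :: "nat list \<Rightarrow> (nat \<Rightarrow> nat) \<Rightarrow> state" where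
  "input_state params a = (\<lambda>r. if r < length params then params ! r else 0, a)"

definition ram_output :: "nat \<Rightarrow> state \<Rightarrow> nat list" where
  "ram_output k s = map (snd s) [0..<k]"

definition ksum_success_prob :: "prog \<Rightarrow> nat list \<Rightarrow> nat \<Rightarrow> nat \<Rightarrow> nat \<Rightarrow> real" where
  "ksum_success_prob P params k Q m = measure_pmf.prob (ksum_dist m Q)
     {a. \<exists>t s. exec P (input_state params a) t s \<and> ksum_solution k Q m a (ram_output k s)}"

definition ksum_time_bound :: "prog \<Rightarrow> nat list \<Rightarrow> nat \<Rightarrow> nat \<Rightarrow> nat \<Rightarrow> bool" where
  "ksum_time_bound P params Q m T \<longleftrightarrow>
     (\<forall>a \<in> ksum_instances m Q. \<exists>t s. exec P (input_state params a) t s \<and> t \<le> T)"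


section \<open>Asymptotics up to polylogarithmic factors\<close>

text \<open>
  The filter \<open>principal S\<close> makes the bounds uniform over the whole parameter set \<open>S\<close>, not just
  eventual. Only meaningful if \<open>g\<close> is bounded below on \<open>S\<close> by a constant greater than \<open>1\<close>.
\<close>

definition soft_bigo :: "'a set \<Rightarrow> ('a \<Rightarrow> real) \<Rightarrow> ('a \<Rightarrow> real) set" where
  "soft_bigo S g = {f. \<exists>c::nat. f \<in> O[principal S](\<lambda>x. g x * ln (g x) ^ c)}"

definition soft_bigomega :: "'a set \<Rightarrow> ('a \<Rightarrow> real) \<Rightarrow> ('a \<Rightarrow> real) set" where
  "soft_bigomega S g = {f. \<exists>c::nat. f \<in> \<Omega>[principal S](\<lambda>x. g x / ln (g x) ^ c)}"

definition soft_bigtheta :: "'a set \<Rightarrow> ('a \<Rightarrow> real) \<Rightarrow> ('a \<Rightarrow> real) set" where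
  "soft_bigtheta S g = soft_bigo S g \<inter> soft_bigomega S g"

end

(*
  Wagner's generalized birthday algorithm, digit by digit, on a stream. A node of level j is a list
  of 2^j indices whose elements sum to v * q^j; it waits in the bucket (j, v mod q) until a node of
  the opposite residue arrives, and then the two form a node of level j + 1 with value
  (w + v) div q. A node of level l is a solution.

  Let d range over the bucket sizes of level j. The expected increase of the sum of d^2 caused by a
  node arriving at level j is at most 1, whatever the state is, as long as the residue of the new
  node is uniform; and it is, because in whatever state the next input element is inserted, its
  higher digits are still uniform when it reaches level j. At most m / 2^j nodes arrive at level j,
  so the expectation of the sum over all j < l of 2^j d^2 is at most l m. Without a solution all
  m indices are distributed over the q 2^l - q waiting lists (counted with multiplicity 2^j), so
  this sum is at least m^2 / (q 2^l) = 2 q l m for m = 2^(l + 1) q^2 l, and Markov's inequality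
  bounds the failure probability by 1 / (2 q).
*)
theory Submission imports Defs
begin

section \<open>Cost of straight-line programs\<close>

text \<open>The bound of 1 on the drift rests on an antisymmetry. Write d(r) for the size of bucket
  r of one level. A node of residue r either finds bucket -r empty and adds 2 d(r) + 1 to the sum of
  squares, or takes a node from it and adds 1 - 2 d(-r). Both are at most 1 + 2 (d(r) - d(-r)), and
  the difference sums to zero over all residues because negation permutes them. The stored nodes may
  be correlated in any way; only the element in hand has to be fresh. How far an element travels
  depends on its predecessors, so the number of arrivals is itself random. It can be read off the
  buckets, though: an index lying at level j < l has arrived at the levels 0 to j. Charging these
  arrivals inside the potential makes its sum over all instances nonpositive, and everything before
  the final probability is an inequality between integer sums. On the machine side one bound X on
  all registers and cells is enough: a straight-line block costs a constant times the squared bit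
  length of X, which is polylogarithmic although X contains \<open>q ^ l\<close>.\<close>

lemma len_ge_1: "1 \<le> len x"
  by (simp add: len_def)

lemma len_mono: "x \<le> y \<Longrightarrow> len x \<le> len y"
  unfolding len_def by (intro max.mono floorlog_mono) auto

lemma less_2_power_len: "x < 2 ^ len x"
proof -
  have "x < 2 ^ floorlog 2 x" by (cases "x = 0") (auto simp: floorlog_bounds)
  also have "\<dots> \<le> 2 ^ len x" by (intro power_increasing) (auto simp: len_def)
  finally show ?thesis .
qed

lemma len_le_iff: "1 \<le> n \<Longrightarrow> len x \<le> n \<longleftrightarrow> x < 2 ^ n"
  by (simp add: len_def floorlog_le_iff)

lemma len_power: "1 \<le> d \<Longrightarrow> len (x ^ d) \<le> d * len x"
proof -
  assume d: "1 \<le> d"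
  have "x ^ d < (2 ^ len x) ^ d"
    using d by (intro power_strict_mono less_2_power_len) auto
  then have "x ^ d < 2 ^ (d * len x)" by (simp add: power_mult mult.commute flip: power_mult)
  then show ?thesis using d len_ge_1[of x] by (subst len_le_iff) auto
qed

definition bounded_state :: "nat \<Rightarrow> state \<Rightarrow> bool" where
  "bounded_state X s \<longleftrightarrow> (\<forall>r. fst s r \<le> X) \<and> (\<forall>a. snd s a \<le> X)"

lemma bounded_state_mono: "bounded_state X s \<Longrightarrow> X \<le> Y \<Longrightarrow> bounded_state Y s"
  unfolding bounded_state_def by (meson le_trans)

text \<open>A syntactic exponent d for which values stay below \<open>X ^ d\<close> whenever the
  state is bounded by \<open>X \<ge> 2\<close>. A constant gets degree n because
  \<open>n < 2 ^ n\<close>; a loaded value is a cell content, hence below \<open>X\<close> no matter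
  how large its address is.\<close>

fun expr_deg :: "expr \<Rightarrow> nat" where
  "expr_deg (Const n) = max 1 n"
| "expr_deg (Reg r) = 1"
| "expr_deg (Load e) = 1"
| "expr_deg (Op b e1 e2) = expr_deg e1 + expr_deg e2"

lemma expr_deg_ge_1: "1 \<le> expr_deg e"
  by (induction e) auto

text \<open>A product dominates the sum once both factors are at least 2, so one multiplicative
  bound covers all five operations and degrees simply add.\<close>

lemma op_val_le: "2 \<le> x \<Longrightarrow> 2 \<le> y \<Longrightarrow> u \<le> x \<Longrightarrow> v \<le> y \<Longrightarrow> op_val b u v \<le> x * y"
proof (cases b)
  case Add
  assume a: "2 \<le> x" "2 \<le> y" "u \<le> x" "v \<le> y"
  have "x + y \<le> x * y"
  proof -
    have "2 * y \<le> x * y" "x * 2 \<le> x * y" using a by auto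
    then show ?thesis by linarith
  qed
  then show ?thesis using a Add by simp
next
  assume a: "2 \<le> x" "2 \<le> y" "u \<le> x" "v \<le> y"
  have x: "x \<le> x * y" using a by simp
  case Sub then show ?thesis using diff_le_self[of u v] x a by (simp only: op_val.simps)
next
  assume a: "2 \<le> x" "2 \<le> y" "u \<le> x" "v \<le> y"
  case Mul then show ?thesis using a by (simp add: mult_le_mono)
next
  assume a: "2 \<le> x" "2 \<le> y" "u \<le> x" "v \<le> y"
  have x: "x \<le> x * y" using a by simp
  case Div then show ?thesis using div_le_dividend[of u v] x a by (simp only: op_val.simps)
next
  assume a: "2 \<le> x" "2 \<le> y" "u \<le> x" "v \<le> y"
  have x: "x \<le> x * y" using a by simp
  case Mod then show ?thesis using mod_less_eq_dividend[of u v] x a by (simp only: op_val.simps)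
qed

lemma val_le:
  assumes "2 \<le> X" "bounded_state X s"
  shows "val e s \<le> X ^ expr_deg e"
proof (induction e)
  case (Const n)
  have "n < 2 ^ n" by simp
  also have "(2::nat) ^ n \<le> X ^ n" using assms(1) by (intro power_mono) auto
  also have "\<dots> \<le> X ^ max 1 n" using assms(1) by (intro power_increasing) auto
  finally show ?case by simp
next
  case (Op b e1 e2)
  have "2 \<le> X ^ expr_deg e" for e
    using assms(1) self_le_power[of X "expr_deg e"] expr_deg_ge_1[of e] by linarith
  with Op show ?case by (simp add: power_add op_val_le)
qed (use assms(2) in \<open>auto simp: bounded_state_def\<close>)

lemma len_val_le:
  assumes "2 \<le> X" "bounded_state X s"
  shows "len (val e s) \<le> expr_deg e * len X"
  using len_mono[OF val_le[OF assms]] len_power[OF expr_deg_ge_1] by (rule le_trans)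

lemma op_cost_le: "op_cost b x y \<le> (len x + len y)\<^sup>2"
proof -
  have "len x + len y \<le> (len x + len y)\<^sup>2"
    using len_ge_1[of x] by (intro self_le_power) auto
  moreover have "len x * len y \<le> (len x + len y)\<^sup>2"
    by (simp add: power2_eq_square algebra_simps)
  ultimately show ?thesis by (cases b) simp_all
qed

lemma le_mult_len_sq: "n \<le> n * (len X)\<^sup>2" for n :: nat
  using len_ge_1[of X] by simp

text \<open>The constant depends on the expression alone. It is chosen before \<open>X\<close>, so
  the same program can later be charged for every input size.\<close>

lemma cost_le: "\<exists>K. \<forall>X\<ge>2. \<forall>s. bounded_state X s \<longrightarrow> cost e s \<le> K * (len X)\<^sup>2"
proof (induction e)
  case (Const n)
  show ?case using le_mult_len_sq by (intro exI[of _ "len n"]) simp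
next
  case (Reg r)
  have "cost (Reg r) s \<le> (len r + 1) * (len X)\<^sup>2" if "2 \<le> X" "bounded_state X s" for X s
  proof -
    have "len (fst s r) \<le> len X" using that by (intro len_mono) (auto simp: bounded_state_def)
    also have "\<dots> \<le> (len X)\<^sup>2" using len_ge_1[of X] by (simp add: power2_eq_square)
    finally show ?thesis
      using le_mult_len_sq[of "len r" X] unfolding cost.simps add_mult_distrib by linarith
  qed
  then show ?case by blast
next
  case (Load e)
  then obtain K where K: "\<And>X s. 2 \<le> X \<Longrightarrow> bounded_state X s \<Longrightarrow> cost e s \<le> K * (len X)\<^sup>2" by blast
  have "cost (Load e) s \<le> (K + expr_deg e + 1) * (len X)\<^sup>2" if "2 \<le> X" "bounded_state X s" for X s
  proof -
    have "len (snd s (val e s)) \<le> len X" using that by (intro len_mono) (auto simp: bounded_state_def)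
    then have "len (val e s) + len (snd s (val e s)) \<le> (expr_deg e + 1) * len X"
      using len_val_le[OF that, of e] by simp
    also have "\<dots> \<le> (expr_deg e + 1) * (len X)\<^sup>2"
      using len_ge_1[of X] by (intro mult_left_mono) (auto simp: power2_eq_square)
    finally show ?thesis using K[OF that] by (simp add: add_mult_distrib)
  qed
  then show ?case by blast
next
  case (Op b e1 e2)
  then obtain K1 K2 where
    K: "\<And>X s. 2 \<le> X \<Longrightarrow> bounded_state X s \<Longrightarrow> cost e1 s \<le> K1 * (len X)\<^sup>2"
       "\<And>X s. 2 \<le> X \<Longrightarrow> bounded_state X s \<Longrightarrow> cost e2 s \<le> K2 * (len X)\<^sup>2" by blast
  have "cost (Op b e1 e2) s \<le> (K1 + K2 + (expr_deg e1 + expr_deg e2)\<^sup>2) * (len X)\<^sup>2"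
    if "2 \<le> X" "bounded_state X s" for X s
  proof -
    have "len (val e1 s) + len (val e2 s) \<le> (expr_deg e1 + expr_deg e2) * len X"
      using len_val_le[OF that, of e1] len_val_le[OF that, of e2] by (simp add: add_mult_distrib)
    then have "(len (val e1 s) + len (val e2 s))\<^sup>2 \<le> (expr_deg e1 + expr_deg e2)\<^sup>2 * (len X)\<^sup>2"
      by (metis power_mono power_mult_distrib zero_le)
    then show ?thesis using K[OF that] op_cost_le[of b "val e1 s" "val e2 s"]
      by (simp add: add_mult_distrib)
  qed
  then show ?case by blast
qed

section \<open>Time and growth of loop-free programs\<close>

fun loopfree :: "prog \<Rightarrow> bool" where
  "loopfree (Seq P1 P2) \<longleftrightarrow> loopfree P1 \<and> loopfree P2"
| "loopfree (Cond e P1 P2) \<longleftrightarrow> loopfree P1 \<and> loopfree P2"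
| "loopfree (While e P) \<longleftrightarrow> False"
| "loopfree _ \<longleftrightarrow> True"

text \<open>A function rather than a relation, so that the simulation can compute final states by
  rewriting. Its value on loops is a dummy; the link to \<open>exec\<close> is made for
  \<open>loopfree\<close> programs only.\<close>

fun sem :: "prog \<Rightarrow> state \<Rightarrow> state" where
  "sem (SetReg r e) s = ((fst s)(r := val e s), snd s)"
| "sem (Store e1 e2) s = (fst s, (snd s)(val e1 s := val e2 s))"
| "sem (Seq P1 P2) s = sem P2 (sem P1 s)"
| "sem (Cond e P1 P2) s = (if val e s \<noteq> 0 then sem P1 s else sem P2 s)"
| "sem _ s = s"

text \<open>The exponent bounds the growth of the registers and cells during \<open>P\<close>, so that a bound on
  the state before a program suffices to bound its cost.\<close>

lemma exec_loopfree:
  assumes "loopfree P"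
  shows "\<exists>K\<ge>1. \<forall>X\<ge>2. \<forall>s. bounded_state X s \<longrightarrow>
    bounded_state (X ^ K) (sem P s) \<and> (\<exists>t\<le>K * (len X)\<^sup>2. exec P s t (sem P s))"
  using assms
proof (induction P)
  case Skip
  show ?case using exec.Skip le_mult_len_sq[of 1] by (intro exI[of _ 1]) auto
next
  case (SetReg r e)
  obtain K where K: "\<And>X s. 2 \<le> X \<Longrightarrow> bounded_state X s \<Longrightarrow> cost e s \<le> K * (len X)\<^sup>2"
    using cost_le by blast
  define K' where "K' = K + len r + expr_deg e"
  have "bounded_state (X ^ K') (sem (SetReg r e) s) \<and>
      (\<exists>t\<le>K' * (len X)\<^sup>2. exec (SetReg r e) s t (sem (SetReg r e) s))"
    if st: "2 \<le> X" "bounded_state X s" for X s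
  proof
    have "X ^ 1 \<le> X ^ K'" "X ^ expr_deg e \<le> X ^ K'"
      using st expr_deg_ge_1[of e] by (intro power_increasing; simp add: K'_def)+
    then show "bounded_state (X ^ K') (sem (SetReg r e) s)"
      using st val_le[OF st, of e] unfolding bounded_state_def by (auto intro: le_trans)
    have "len (val e s) \<le> expr_deg e * (len X)\<^sup>2"
      using len_val_le[OF st, of e] len_ge_1[of X]
      by (meson le_trans mult_le_mono2 self_le_power zero_less_numeral)
    then have "cost e s + len r + len (val e s) \<le> K' * (len X)\<^sup>2"
      using K[OF st] le_mult_len_sq[of "len r" X] unfolding K'_def add_mult_distrib by linarith
    then show "\<exists>t\<le>K' * (len X)\<^sup>2. exec (SetReg r e) s t (sem (SetReg r e) s)"
      using exec.SetReg[of r e s] by (auto simp only: sem.simps)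
  qed
  moreover have "1 \<le> K'" using expr_deg_ge_1[of e] by (simp add: K'_def)
  ultimately show ?case by blast
next
  case (Store e1 e2)
  obtain K1 K2 where
    K: "\<And>X s. 2 \<le> X \<Longrightarrow> bounded_state X s \<Longrightarrow> cost e1 s \<le> K1 * (len X)\<^sup>2"
       "\<And>X s. 2 \<le> X \<Longrightarrow> bounded_state X s \<Longrightarrow> cost e2 s \<le> K2 * (len X)\<^sup>2"
    using cost_le by meson
  define K' where "K' = K1 + K2 + expr_deg e1 + expr_deg e2"
  have "bounded_state (X ^ K') (sem (Store e1 e2) s) \<and>
      (\<exists>t\<le>K' * (len X)\<^sup>2. exec (Store e1 e2) s t (sem (Store e1 e2) s))"
    if st: "2 \<le> X" "bounded_state X s" for X s
  proof
    have "X ^ 1 \<le> X ^ K'" "X ^ expr_deg e2 \<le> X ^ K'"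
      using st expr_deg_ge_1[of e2] by (intro power_increasing; simp add: K'_def)+
    then show "bounded_state (X ^ K') (sem (Store e1 e2) s)"
      using st val_le[OF st, of e2] unfolding bounded_state_def by (auto intro: le_trans)
    have "len (val e s) \<le> expr_deg e * (len X)\<^sup>2" for e
      using len_val_le[OF st, of e] len_ge_1[of X]
      by (meson le_trans mult_le_mono2 self_le_power zero_less_numeral)
    from this[of e1] this[of e2]
    have "cost e1 s + cost e2 s + len (val e1 s) + len (val e2 s) \<le> K' * (len X)\<^sup>2"
      using K[OF st] unfolding K'_def add_mult_distrib by linarith
    then show "\<exists>t\<le>K' * (len X)\<^sup>2. exec (Store e1 e2) s t (sem (Store e1 e2) s)"
      using exec.Store[of e1 e2 s] by (auto simp only: sem.simps)
  qed
  moreover have "1 \<le> K'" using expr_deg_ge_1[of e1] by (simp add: K'_def)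
  ultimately show ?case by blast
next
  case (Seq P1 P2)
  then obtain K1 K2 where ge: "1 \<le> K1" "1 \<le> K2" and
    K1: "\<And>X s. 2 \<le> X \<Longrightarrow> bounded_state X s \<Longrightarrow>
      bounded_state (X ^ K1) (sem P1 s) \<and> (\<exists>t\<le>K1 * (len X)\<^sup>2. exec P1 s t (sem P1 s))" and
    K2: "\<And>X s. 2 \<le> X \<Longrightarrow> bounded_state X s \<Longrightarrow>
      bounded_state (X ^ K2) (sem P2 s) \<and> (\<exists>t\<le>K2 * (len X)\<^sup>2. exec P2 s t (sem P2 s))"
    by auto
  \<comment> \<open>\<open>P2\<close> starts from a state bounded by \<open>X ^ K1\<close>, whose
    length is at most \<open>K1 * len X\<close>; squaring this length yields the factor
    \<open>K1\<^sup>2\<close>. The exponent \<open>K1 * K2\<close> of the final state is covered as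
    well.\<close>
  define K where "K = K1 + K1\<^sup>2 * K2"
  have "bounded_state (X ^ K) (sem (Seq P1 P2) s) \<and>
      (\<exists>t\<le>K * (len X)\<^sup>2. exec (Seq P1 P2) s t (sem (Seq P1 P2) s))"
    if st: "2 \<le> X" "bounded_state X s" for X s
  proof -
    have X: "2 \<le> X ^ K1" using st(1) ge(1) self_le_power[of X K1] by linarith
    obtain t1 where t1: "t1 \<le> K1 * (len X)\<^sup>2" "exec P1 s t1 (sem P1 s)"
      and b1: "bounded_state (X ^ K1) (sem P1 s)" using K1[OF st] by blast
    obtain t2 where t2: "t2 \<le> K2 * (len (X ^ K1))\<^sup>2" "exec P2 (sem P1 s) t2 (sem P2 (sem P1 s))"
      and b2: "bounded_state ((X ^ K1) ^ K2) (sem P2 (sem P1 s))" using K2[OF X b1] by blast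
    have "K1 * K2 \<le> K1\<^sup>2 * K2" using ge by (simp add: power2_eq_square)
    then have "K1 * K2 \<le> K" unfolding K_def by linarith
    then have "(X ^ K1) ^ K2 \<le> X ^ K"
      using st power_increasing[of "K1 * K2" K X] by (simp flip: power_mult)
    then have "bounded_state (X ^ K) (sem (Seq P1 P2) s)"
      using bounded_state_mono[OF b2] by simp
    moreover have "(len (X ^ K1))\<^sup>2 \<le> (K1 * len X)\<^sup>2"
      by (intro power_mono len_power ge) auto
    then have "t2 \<le> K2 * (K1 * len X)\<^sup>2"
      using t2(1) by (meson le_trans mult_le_mono2)
    then have "t1 + t2 \<le> K * (len X)\<^sup>2"
      using t1(1) by (simp add: K_def power_mult_distrib algebra_simps)
    ultimately show ?thesis using exec.Seq[OF t1(2) t2(2)] by auto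
  qed
  moreover have "1 \<le> K" using ge by (simp add: K_def)
  ultimately show ?case by blast
next
  case (Cond e P1 P2)
  then obtain K1 K2 where ge: "1 \<le> K1" "1 \<le> K2" and
    K1: "\<And>X s. 2 \<le> X \<Longrightarrow> bounded_state X s \<Longrightarrow>
      bounded_state (X ^ K1) (sem P1 s) \<and> (\<exists>t\<le>K1 * (len X)\<^sup>2. exec P1 s t (sem P1 s))" and
    K2: "\<And>X s. 2 \<le> X \<Longrightarrow> bounded_state X s \<Longrightarrow>
      bounded_state (X ^ K2) (sem P2 s) \<and> (\<exists>t\<le>K2 * (len X)\<^sup>2. exec P2 s t (sem P2 s))"
    by auto
  obtain K0 where K0: "\<And>X s. 2 \<le> X \<Longrightarrow> bounded_state X s \<Longrightarrow> cost e s \<le> K0 * (len X)\<^sup>2"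
    using cost_le by blast
  define K where "K = K0 + K1 + K2"
  have "bounded_state (X ^ K) (sem (Cond e P1 P2) s) \<and>
      (\<exists>t\<le>K * (len X)\<^sup>2. exec (Cond e P1 P2) s t (sem (Cond e P1 P2) s))"
    if st: "2 \<le> X" "bounded_state X s" for X s
  proof -
    have X: "X ^ K1 \<le> X ^ K" "X ^ K2 \<le> X ^ K"
      using st by (intro power_increasing; simp add: K_def)+
    show ?thesis
    proof (cases "val e s = 0")
      case True
      obtain t where t: "t \<le> K2 * (len X)\<^sup>2" "exec P2 s t (sem P2 s)" using K2[OF st] by blast
      have "cost e s + t \<le> K * (len X)\<^sup>2"
        using K0[OF st] t(1) by (simp add: K_def add_mult_distrib)
      moreover have "exec (Cond e P1 P2) s (cost e s + t) (sem P2 s)"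
        using True t(2) by (rule exec.CondFalse)
      moreover have "bounded_state (X ^ K) (sem P2 s)"
        using K2[OF st] X(2) bounded_state_mono by blast
      ultimately show ?thesis using True by auto
    next
      case False
      obtain t where t: "t \<le> K1 * (len X)\<^sup>2" "exec P1 s t (sem P1 s)" using K1[OF st] by blast
      have "cost e s + t \<le> K * (len X)\<^sup>2"
        using K0[OF st] t(1) by (simp add: K_def add_mult_distrib)
      moreover have "exec (Cond e P1 P2) s (cost e s + t) (sem P1 s)"
        using False t(2) by (rule exec.CondTrue)
      moreover have "bounded_state (X ^ K) (sem P1 s)"
        using K1[OF st] X(1) bounded_state_mono by blast
      ultimately show ?thesis using False by auto
    qed
  qed
  moreover have "1 \<le> K" using ge by (simp add: K_def)
  ultimately show ?case by blast
qed auto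

section \<open>Insertion into the buckets\<close>

type_synonym node = "nat \<times> nat list"
type_synonym buckets = "nat \<Rightarrow> nat \<Rightarrow> node list"

definition upd :: "buckets \<Rightarrow> nat \<Rightarrow> nat \<Rightarrow> node list \<Rightarrow> buckets" where
  "upd B j r ns = B(j := (B j)(r := ns))"

lemma upd_apply: "upd B j r ns j' r' = (if j' = j \<and> r' = r then ns else B j' r')"
  by (simp add: upd_def)

text \<open>\<open>n\<close> is the number of levels left, so \<open>j + n = l\<close> throughout.\<close>

fun insert_node :: "nat \<Rightarrow> nat \<Rightarrow> nat \<Rightarrow> buckets \<Rightarrow> nat \<Rightarrow> nat list \<Rightarrow> buckets" where
  "insert_node q 0 j B v is = upd B j 0 ((v, is) # B j 0)"
| "insert_node q (Suc n) j B v is =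
    (case B j ((q - v mod q) mod q) of
       [] \<Rightarrow> upd B j (v mod q) ((v, is) # B j (v mod q))
     | (w, js) # ns \<Rightarrow>
         insert_node q n (Suc j) (upd B j ((q - v mod q) mod q) ns) ((w + v) div q) (js @ is))"

text \<open>Generic in the monoid because the same sum serves three times: for the multiset of
  stored indices, for their number, and for the potential.\<close>

definition bucket_sum :: "nat \<Rightarrow> nat \<Rightarrow> (nat \<Rightarrow> node list \<Rightarrow> 'a) \<Rightarrow> buckets \<Rightarrow> 'a::comm_monoid_add" where
  "bucket_sum l q f B = (\<Sum>j\<le>l. \<Sum>r<q. f j (B j r))"

text \<open>Old and new contributions stand on opposite sides, without subtraction, so that the rule
  also applies to multisets.\<close>

lemma bucket_sum_upd:
  assumes "j \<le> l" "r < q"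
  shows "bucket_sum l q f (upd B j r ns) + f j (B j r) = bucket_sum l q f B + f j ns"
proof -
  have eq: "bucket_sum l q f B' = f j (B' j r) + (\<Sum>r'\<in>{..<q}-{r}. f j (B' j r')) +
      (\<Sum>j'\<in>{..l}-{j}. \<Sum>r'<q. f j' (B' j' r'))" for B'
    unfolding bucket_sum_def using assms by (simp add: sum.remove[of _ j] sum.remove[of _ r])
  have "(\<Sum>r'\<in>{..<q}-{r}. f j (upd B j r ns j r')) = (\<Sum>r'\<in>{..<q}-{r}. f j (B j r'))"
    by (intro sum.cong) (auto simp: upd_apply)
  moreover have "(\<Sum>j'\<in>{..l}-{j}. \<Sum>r'<q. f j' (upd B j r ns j' r')) = (\<Sum>j'\<in>{..l}-{j}. \<Sum>r'<q. f j' (B j' r'))"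
    by (intro sum.cong) (auto simp: upd_apply)
  ultimately show ?thesis by (simp add: eq upd_apply algebra_simps)
qed

section \<open>Conservation of indices\<close>

definition node_leaves :: "nat \<Rightarrow> node list \<Rightarrow> nat multiset" where
  "node_leaves j ns = (\<Sum>n\<leftarrow>ns. mset (snd n))"

definition leaves :: "nat \<Rightarrow> nat \<Rightarrow> buckets \<Rightarrow> nat multiset" where
  "leaves l q = bucket_sum l q node_leaves"

lemma leaves_push:
  assumes "j \<le> l" "r < q"
  shows "leaves l q (upd B j r ((v, is) # B j r)) = leaves l q B + mset is"
  using bucket_sum_upd[OF assms, of node_leaves B "(v, is) # B j r"]
  by (simp add: leaves_def node_leaves_def ac_simps)

lemma leaves_pop:
  assumes "j \<le> l" "r < q" "B j r = (w, js) # ns"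
  shows "leaves l q B = leaves l q (upd B j r ns) + mset js"
  using bucket_sum_upd[OF assms(1,2), of node_leaves B ns] assms(3)
  by (simp add: leaves_def node_leaves_def ac_simps)

text \<open>Pairing only moves indices between nodes. As an equation of multisets this later yields
  that solutions have distinct indices, that the lists hold all \<open>m\<close> of them, and that
  nodes own disjoint memory cells.\<close>

lemma leaves_insert_node:
  assumes "0 < q" "j + n = l"
  shows "leaves l q (insert_node q n j B v is) = leaves l q B + mset is"
  using assms(2)
proof (induction n arbitrary: j B v "is")
  case 0
  then show ?case using assms(1) by (simp add: leaves_push)
next
  case (Suc n)
  show ?case
  proof (cases "B j ((q - v mod q) mod q)")
    case Nil
    then show ?thesis using Suc.prems assms(1) by (simp add: leaves_push)
  next
    case (Cons p ns)
    obtain w js where p: "p = (w, js)" by force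
    have "leaves l q B = leaves l q (upd B j ((q - v mod q) mod q) ns) + mset js"
      by (rule leaves_pop) (use Suc.prems assms(1) Cons p in auto)
    then show ?thesis using Suc.IH[of "Suc j"] Suc.prems Cons p by (simp add: ac_simps)
  qed
qed

lemma in_leaves:
  assumes "j \<le> l" "r < q" "(v, is) \<in> set (B j r)"
  shows "mset is \<subseteq># leaves l q B"
proof -
  have "mset is \<subseteq># node_leaves j (B j r)"
    using assms(3) unfolding node_leaves_def
    by (auto dest!: split_list)
  also have "\<dots> \<subseteq># (\<Sum>r<q. node_leaves j (B j r))"
    using assms by (simp add: sum.remove[of _ r])
  also have "\<dots> \<subseteq># leaves l q B"
    using assms by (simp add: leaves_def bucket_sum_def sum.remove[of _ j])
  finally show ?thesis .
qed

text \<open>With \<open>d\<close> the length of \<open>ns\<close>, this is \<open>2\<^sup>j d\<^sup>2\<close> for \<open>j < l\<close>, minus \<open>2\<^sup>j d\<close> for each of the levels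
  below \<open>l\<close> at which the indices in \<open>ns\<close> have arrived, that is, for \<open>min (j + 1) l\<close> levels.\<close>

definition weight :: "nat \<Rightarrow> nat \<Rightarrow> node list \<Rightarrow> int" where
  "weight l j ns = (let d = int (length ns) in
     if j < l then 2 ^ j * (d\<^sup>2 - (int j + 1) * d) else - (int l * 2 ^ l * d))"

definition potential :: "nat \<Rightarrow> nat \<Rightarrow> buckets \<Rightarrow> int" where
  "potential l q = bucket_sum l q (weight l)"

section \<open>Uniform digits and the drift of the potential\<close>

lemma sum_digits:
  fixes f :: "nat \<Rightarrow> 'a::comm_monoid_add"
  shows "(\<Sum>a<q ^ Suc n. f a) = (\<Sum>b<q. \<Sum>a<q ^ n. f (b + q * a))"
proof -
  have shift: "sum f {k..<k + q} = (\<Sum>b<q. f (b + k))" for k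
    using sum.shift_bounds_nat_ivl[of f 0 k q] by (simp add: atLeast0LessThan add.commute)
  have "(\<Sum>a<q ^ Suc n. f a) = (\<Sum>a<q ^ n. \<Sum>b\<in>{a*q..<a*q+q}. f b)"
    by (simp only: power_Suc2 sum.nat_group)
  also have "\<dots> = (\<Sum>a<q ^ n. \<Sum>b<q. f (b + q * a))"
    by (simp only: shift mult.commute[of q])
  also have "\<dots> = (\<Sum>b<q. \<Sum>a<q ^ n. f (b + q * a))" by (rule sum.swap)
  finally show ?thesis .
qed

text \<open>Translation permutes the residues: a uniform digit stays uniform after any value has
  been added to it.\<close>

lemma sum_shift_mod:
  fixes f :: "nat \<Rightarrow> 'a::comm_monoid_add"
  shows "(\<Sum>b<q. f ((v + b) mod q)) = (\<Sum>r<q. f r)"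
proof (rule sum.reindex_bij_betw)
  have "inj_on (\<lambda>b. (v + b) mod q) {..<q}"
    by (intro inj_onI) (metis cong_add_lcancel_nat cong_def lessThan_iff mod_less)
  moreover have "(\<lambda>b. (v + b) mod q) ` {..<q} \<subseteq> {..<q}" by auto
  ultimately show "bij_betw (\<lambda>b. (v + b) mod q) {..<q} {..<q}"
    by (simp add: bij_betw_def endo_inj_surj)
qed

lemma neg_mod_neg_mod: "(q - (q - r) mod q) mod q = r" if "r < q" for q r :: nat
  using that by (cases "r = 0") auto

text \<open>Negation, written \<open>(q - r) mod q\<close> so that 0 is sent to 0, is an involution
  on the residues. This is what cancels the drift.\<close>

lemma sum_neg_mod:
  fixes f :: "nat \<Rightarrow> 'a::comm_monoid_add"
  shows "(\<Sum>r<q. f ((q - r) mod q)) = (\<Sum>r<q. f r)"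
  by (rule sum.reindex_bij_witness[where i = "\<lambda>r. (q - r) mod q" and j = "\<lambda>r. (q - r) mod q"])
     (auto simp: neg_mod_neg_mod)

lemma potential_upd:
  assumes "j \<le> l" "r < q"
  shows "potential l q (upd B j r ns) = potential l q B + (weight l j ns - weight l j (B j r))"
  using bucket_sum_upd[OF assms, of "weight l" B ns] by (simp add: potential_def)

lemma potential_push_last:
  assumes "0 < q"
  shows "potential l q (upd B l 0 ((v, is) # B l 0)) = potential l q B - int l * 2 ^ l"
proof -
  have "weight l l (n # ns) - weight l l ns = - (int l * 2 ^ l)" for n ns
    by (simp add: weight_def ring_distribs)
  then show ?thesis using assms by (simp add: potential_upd)
qed

text \<open>The 1 in \<open>(d + 1)\<^sup>2 - d\<^sup>2 = 2 * d + 1\<close> pays for the arrival at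
  level \<open>j\<close> itself. What remains is the charge for the \<open>j\<close> levels
  below.\<close>

lemma weight_Cons:
  assumes "j < l"
  shows "weight l j (n # ns) = weight l j ns + 2 ^ Suc j * int (length ns) - int j * 2 ^ j"
proof -
  have "P * ((1 + d)\<^sup>2 - (k + 1) * (1 + d)) = P * (d\<^sup>2 - (k + 1) * d) + 2 * P * d - k * P"
    for P d k :: int by algebra
  then show ?thesis using assms by (simp add: weight_def Let_def)
qed

lemma potential_push:
  assumes "j < l" "r < q"
  shows "potential l q (upd B j r ((v, is) # B j r)) =
    potential l q B - int j * 2 ^ j + 2 ^ Suc j * int (length (B j r))"
  using assms by (simp add: potential_upd weight_Cons)

lemma potential_pop:
  assumes "j < l" "r < q" "B j r = n # ns"
  shows "potential l q (upd B j r ns) =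
    potential l q B + int (j + 2) * 2 ^ j - 2 ^ Suc j * int (length (B j r))"
  using assms by (simp add: potential_upd weight_Cons ring_distribs)

text \<open>Inserted at level \<open>j\<close>, the lowest digit of \<open>v + a\<close> is uniform, and for each value of that digit
  the node passed on to level \<open>j + 1\<close> again has the form \<open>v' + a'\<close> with \<open>a'\<close> uniform. The term
  \<open>j * 2 ^ j\<close> is the weight of the node in hand.\<close>

lemma sum_potential_insert_node:
  assumes "0 < q" "j + n = l"
  shows "(\<Sum>a<q ^ n. potential l q (insert_node q n j B (v + a) is))
    \<le> int (q ^ n) * (potential l q B - int j * 2 ^ j)"
  using assms(2)
proof (induction n arbitrary: j B v "is")
  case 0
  then show ?case using assms(1) by (simp add: potential_push_last)
next
  case (Suc n)
  define d where "d r = int (length (B j r))" for r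
  \<comment> \<open>Exact for a push, where the opposite bucket is empty; for a pop the term
    \<open>d r\<close> is slack.\<close>
  define g where "g r = d r - d ((q - r) mod q)" for r
  have *: "(\<Sum>a<q ^ n. potential l q (insert_node q (Suc n) j B (v + (b + q * a)) is))
     \<le> int (q ^ n) * (potential l q B - int j * 2 ^ j + 2 ^ Suc j * g ((v + b) mod q))" (is "?L b \<le> _") for b
  proof -
    let ?r = "(v + b) mod q" let ?r' = "(q - ?r) mod q"
    have r: "(v + (b + q * a)) mod q = ?r" for a
      by (simp flip: add.assoc)
    show ?thesis
    proof (cases "B j ?r'")
      case Nil
      then have "insert_node q (Suc n) j B (v + (b + q * a)) is =
          upd B j ?r ((v + (b + q * a), is) # B j ?r)" for a
        by (simp add: r)
      then show ?thesis using Suc.prems assms(1) Nil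
        by (simp add: potential_push g_def d_def)
    next
      case (Cons p ns)
      obtain w js where p: "p = (w, js)" by force
      \<comment> \<open>The carry from the lower digits changes only the offset, not the
        distribution: the upper part \<open>a\<close> survives the division unchanged.\<close>
      have carry: "(w + (v + (b + q * a))) div q = (w + v + b) div q + a" for a
        using assms(1) by (simp flip: add.assoc)
      have pop: "potential l q (upd B j ?r' ns) = potential l q B + int (j + 2) * 2 ^ j - 2 ^ Suc j * d ?r'"
        using Suc.prems assms(1) Cons by (simp add: d_def potential_pop)
      from Cons p have "?L b = (\<Sum>a<q ^ n. potential l q (insert_node q n (Suc j) (upd B j ?r' ns) ((w + v + b) div q + a) (js @ is)))"
        by (simp add: r carry)
      also have "\<dots> \<le> int (q ^ n) * (potential l q (upd B j ?r' ns) - int (Suc j) * 2 ^ Suc j)"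
        by (rule Suc.IH) (use Suc.prems in simp)
      \<comment> \<open>The pop releases \<open>(j + 2) * 2 ^ j\<close> and the merged node in hand
        costs \<open>(j + 1) * 2 ^ (j + 1)\<close>, a balance of \<open>- j * 2 ^ j\<close>. The
        nonnegative term with \<open>d ?r\<close> is added for free.\<close>
      also have "\<dots> \<le> int (q ^ n) * (potential l q B - int j * 2 ^ j + 2 ^ Suc j * g ?r)"
        unfolding pop by (intro mult_left_mono) (simp_all add: g_def d_def ring_distribs)
      finally show ?thesis .
    qed
  qed
  have "(\<Sum>a<q ^ Suc n. potential l q (insert_node q (Suc n) j B (v + a) is)) = (\<Sum>b<q. ?L b)"
    by (rule sum_digits)
  also have "\<dots> \<le> (\<Sum>b<q. int (q ^ n) * (potential l q B - int j * 2 ^ j + 2 ^ Suc j * g ((v + b) mod q)))"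
    by (intro sum_mono *)
  also have "\<dots> = (\<Sum>r<q. int (q ^ n) * (potential l q B - int j * 2 ^ j + 2 ^ Suc j * g r))"
    by (rule sum_shift_mod)
  also have "\<dots> = int (q ^ Suc n) * (potential l q B - int j * 2 ^ j) + int (q ^ n) * 2 ^ Suc j * (\<Sum>r<q. g r)"
    by (simp add: distrib_left sum.distrib mult.assoc flip: sum_distrib_left)
  also have "(\<Sum>r<q. g r) = 0"
    by (simp add: g_def sum_subtractf sum_neg_mod)
  finally show ?case by simp
qed

section \<open>Success probability\<close>

fun process :: "nat \<Rightarrow> nat \<Rightarrow> (nat \<Rightarrow> nat) \<Rightarrow> nat \<Rightarrow> buckets" where
  "process l q a 0 = (\<lambda>_ _. [])"
| "process l q a (Suc i) = insert_node q l 0 (process l q a i) (a i) [i]"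

text \<open>The buckets depend only on elements already read. This makes the next element fresh and
  lets it be summed out for a fixed prefix.\<close>

lemma process_cong: "(\<And>k. k < i \<Longrightarrow> a k = b k) \<Longrightarrow> process l q a i = process l q b i"
  by (induction i) auto

lemma leaves_process: "0 < q \<Longrightarrow> leaves l q (process l q a i) = mset [0..<i]"
proof (induction i)
  case 0
  then show ?case by (simp add: leaves_def bucket_sum_def node_leaves_def)
qed (simp add: leaves_insert_node)

section \<open>Soundness of the stored nodes\<close>

definition partial_sol :: "nat \<Rightarrow> nat \<Rightarrow> (nat \<Rightarrow> nat) \<Rightarrow> nat \<Rightarrow> nat \<Rightarrow> nat list \<Rightarrow> bool" where
  "partial_sol l q a j v is \<longleftrightarrow>
    length is = 2 ^ j \<and> v * q ^ j = (\<Sum>i\<leftarrow>is. a i) \<and> v < q ^ l"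

definition valid_buckets :: "nat \<Rightarrow> nat \<Rightarrow> (nat \<Rightarrow> nat) \<Rightarrow> buckets \<Rightarrow> bool" where
  "valid_buckets l q a B \<longleftrightarrow> (\<forall>j r. \<forall>(v, is) \<in> set (B j r).
     partial_sol l q a j v is \<and> j \<le> l \<and> r = (if j < l then v mod q else 0))"

lemma valid_bucketsD:
  assumes "valid_buckets l q a B" "(v, is) \<in> set (B j r)"
  shows "partial_sol l q a j v is" "j \<le> l" "r = (if j < l then v mod q else 0)"
  using assms unfolding valid_buckets_def by fastforce+

lemma valid_buckets_upd:
  assumes "valid_buckets l q a B"
    and "\<And>v is. (v, is) \<in> set ns \<Longrightarrow> (v, is) \<in> set (B j r) \<or>
      partial_sol l q a j v is \<and> j \<le> l \<and> r = (if j < l then v mod q else 0)"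
  shows "valid_buckets l q a (upd B j r ns)"
  unfolding valid_buckets_def
proof (intro allI ballI, clarify)
  fix j' r' v "is" assume "(v, is) \<in> set (upd B j r ns j' r')"
  then show "partial_sol l q a j' v is \<and> j' \<le> l \<and> r' = (if j' < l then v mod q else 0)"
    using assms(2)[of v "is"] valid_bucketsD[OF assms(1), of v "is" j' r']
    by (cases "j' = j \<and> r' = r") (auto simp: upd_apply)
qed

text \<open>Division by \<open>q \<ge> 2\<close> compensates for adding two values, so values never
  outgrow the input range and fit one memory bound.\<close>

lemma div_sum_less: "(w + v) div q < b" if "2 \<le> q" "w < b" "v < b" for w v q b :: nat
proof -
  have "w + v < b * 2" using that by simp
  also have "\<dots> \<le> b * q" using that by simp
  finally show ?thesis by (simp add: less_mult_imp_div_less)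
qed

text \<open>Opposite residues make \<open>w + v\<close> divisible by \<open>q\<close>, so the
  division is exact and the sum identity holds in the naturals, not merely modulo
  \<open>q ^ l\<close>. At level \<open>l\<close> it exhibits the index sum as a multiple of
  \<open>q ^ l\<close>.\<close>

lemma partial_sol_combine:
  assumes "2 \<le> q" "partial_sol l q a j w js" "partial_sol l q a j v is"
    and "w mod q = (q - v mod q) mod q"
  shows "partial_sol l q a (Suc j) ((w + v) div q) (js @ is)"
proof -
  have "(w + v) mod q = ((q - v mod q) + v mod q) mod q"
    using assms(4) by (metis mod_add_eq mod_mod_trivial)
  also have "\<dots> = 0" using assms(1) by simp
  finally have "(w + v) div q * q = w + v" by (simp add: mod_eq_0_iff_dvd)
  then have "(w + v) div q * q ^ Suc j = (w + v) * q ^ j" by (simp add: mult.assoc[symmetric])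
  then show ?thesis using assms(1-3) div_sum_less[of q w "q ^ l" v]
    by (auto simp: partial_sol_def ring_distribs)
qed

lemma valid_buckets_insert_node:
  assumes "2 \<le> q" "j + n = l" "valid_buckets l q a B" "partial_sol l q a j v is"
  shows "valid_buckets l q a (insert_node q n j B v is)"
  using assms(2-)
proof (induction n arbitrary: j B v "is")
  case 0
  then show ?case by (auto intro!: valid_buckets_upd)
next
  case (Suc n)
  show ?case
  proof (cases "B j ((q - v mod q) mod q)")
    case Nil
    then show ?thesis using Suc.prems by (auto intro!: valid_buckets_upd)
  next
    case (Cons p ns)
    obtain w js where p: "p = (w, js)" by force
    have "(w, js) \<in> set (B j ((q - v mod q) mod q))" using Cons p by simp
    then have "partial_sol l q a j w js" "w mod q = (q - v mod q) mod q"
      using Suc.prems unfolding valid_buckets_def by fastforce+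
    then have "partial_sol l q a (Suc j) ((w + v) div q) (js @ is)"
      using Suc.prems assms(1) by (intro partial_sol_combine)
    moreover have "valid_buckets l q a (upd B j ((q - v mod q) mod q) ns)"
      using Suc.prems Cons by (intro valid_buckets_upd) auto
    ultimately show ?thesis using Suc.IH[of "Suc j"] Suc.prems Cons p by simp
  qed
qed

lemma valid_buckets_process:
  assumes "2 \<le> q" "\<And>k. k < i \<Longrightarrow> a k < q ^ l"
  shows "valid_buckets l q a (process l q a i)"
  using assms(2)
proof (induction i)
  case 0
  then show ?case by (simp add: valid_buckets_def)
next
  case (Suc i)
  then show ?case using assms(1)
    by (auto intro!: valid_buckets_insert_node simp: partial_sol_def)
qed

lemma bucket_count:
  assumes "valid_buckets l q a B" "leaves l q B = mset [0..<m]"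
  shows "bucket_sum l q (\<lambda>j ns. 2 ^ j * length ns) B = m"
proof -
  have "size (node_leaves j ns) = 2 ^ j * length ns"
    if "\<And>v is. (v, is) \<in> set ns \<Longrightarrow> length is = 2 ^ j" for j and ns :: "node list"
    using that by (induction ns) (fastforce simp: node_leaves_def)+
  moreover have "length is = 2 ^ j" if "(v, is) \<in> set (B j r)" for j r v "is"
    using valid_bucketsD(1)[OF assms(1) that] by (simp add: partial_sol_def)
  ultimately have *: "size (node_leaves j (B j r)) = 2 ^ j * length (B j r)" for j r
    by blast
  have "m = size (leaves l q B)" by (simp add: assms(2))
  also have "\<dots> = (\<Sum>j\<le>l. \<Sum>r<q. size (node_leaves j (B j r)))"
    by (simp add: leaves_def bucket_sum_def)
  finally show ?thesis by (simp add: * bucket_sum_def)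
qed

section \<open>Lower bounds on the potential\<close>

lemma weight_Nil [simp]: "weight l j [] = 0"
  by (simp add: weight_def)

text \<open>Without the squares only the arrival charges are left, at most \<open>l\<close> per
  index. This crude bound is used for the solved instances.\<close>

lemma weight_ge:
  assumes "1 \<le> l" "j \<le> l"
  shows "weight l j ns \<ge> - int l * (2 ^ j * int (length ns))"
proof -
  show ?thesis
  proof (cases "j < l")
    case True
    then have "(int j + 1) * int (length ns) \<le> int l * int (length ns)"
      by (intro mult_right_mono) auto
    then have "- (int l * int (length ns)) \<le> (int (length ns))\<^sup>2 - (int j + 1) * int (length ns)"
      using zero_le_power2[of "int (length ns)"] by linarith
    then have "2 ^ j * - (int l * int (length ns)) \<le> 2 ^ j * ((int (length ns))\<^sup>2 - (int j + 1) * int (length ns))"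
      by (intro mult_left_mono) auto
    then show ?thesis using True by (simp add: weight_def Let_def mult_ac)
  next
    case False
    then show ?thesis using assms by (simp add: weight_def Let_def)
  qed
qed

lemma weight_ge_linear:
  assumes "j < l"
  shows "weight l j ns \<ge> (2 * t - int l) * (2 ^ j * int (length ns)) - t\<^sup>2 * 2 ^ j"
proof -
  let ?d = "int (length ns)"
  \<comment> \<open>\<open>d\<^sup>2 \<ge> 2 t d - t\<^sup>2\<close> replaces the Cauchy-Schwarz inequality.\<close>
  have "0 \<le> (?d - t)\<^sup>2" by simp
  moreover have "(int j + 1) * ?d \<le> int l * ?d"
    using assms by (intro mult_right_mono) auto
  ultimately have "(2 * t - int l) * ?d - t\<^sup>2 \<le> ?d\<^sup>2 - (int j + 1) * ?d"
    by (simp add: power2_diff algebra_simps)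
  then have "2 ^ j * ((2 * t - int l) * ?d - t\<^sup>2) \<le> 2 ^ j * (?d\<^sup>2 - (int j + 1) * ?d)"
    by (intro mult_left_mono) auto
  then show ?thesis using assms by (simp add: weight_def Let_def right_diff_distrib mult_ac)
qed

lemma potential_ge:
  assumes "1 \<le> l" "valid_buckets l q a B" "leaves l q B = mset [0..<m]"
  shows "potential l q B \<ge> - (int l * int m)"
proof -
  have "- (int l * int m) = (\<Sum>j\<le>l. \<Sum>r<q. - int l * (2 ^ j * int (length (B j r))))"
    by (simp flip: bucket_count[OF assms(2,3)] add: bucket_sum_def sum_distrib_left sum_negf)
  also have "\<dots> \<le> potential l q B"
    unfolding potential_def bucket_sum_def by (intro sum_mono weight_ge) (use assms in auto)
  finally show ?thesis .
qed

text \<open>All \<open>m\<close> indices wait below level \<open>l\<close>, so the linear parts of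
  the tangent bounds add up to a multiple of \<open>m\<close>, and the constants to
  \<open>t\<^sup>2\<close> times the weighted number of lists, which is less than
  \<open>q * 2 ^ l\<close>.\<close>

lemma potential_ge_unsolved:
  assumes "valid_buckets l q a B" "leaves l q B = mset [0..<m]" "B l 0 = []"
  shows "potential l q B \<ge> (2 * int t - int l) * int m - (int t)\<^sup>2 * int q * 2 ^ l"
proof -
  \<comment> \<open>Top-level nodes are all kept under residue 0, so one empty list means that the
    whole level is empty.\<close>
  have "B l r = []" for r
    using valid_bucketsD(3)[OF assms(1), of _ _ l r] assms(3)
    by (metis less_irrefl list.set_intros(1) neq_Nil_conv surj_pair)
  then have *: "(\<Sum>r<q. f l (B l r)) = (\<Sum>r<q. f l [])" for f :: "nat \<Rightarrow> node list \<Rightarrow> int"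
    by simp
  have split: "bucket_sum l q f B = (\<Sum>j<l. \<Sum>r<q. f j (B j r)) + (\<Sum>r<q. f l [])"
    for f :: "nat \<Rightarrow> node list \<Rightarrow> int"
    by (simp add: bucket_sum_def * flip: lessThan_Suc_atMost)
  have "int m = bucket_sum l q (\<lambda>j ns. 2 ^ j * int (length ns)) B"
    by (simp flip: bucket_count[OF assms(1,2)] add: bucket_sum_def)
  then have m: "int m = (\<Sum>j<l. \<Sum>r<q. 2 ^ j * int (length (B j r)))"
    by (simp add: split)
  have "(\<Sum>j<l. 2 ^ j) \<le> (2 ^ l :: int)"
    by (simp add: mask_eq_sum_exp[symmetric] lessThan_def)
  then have "(int t)\<^sup>2 * int q * (\<Sum>j<l. 2 ^ j) \<le> (int t)\<^sup>2 * int q * 2 ^ l"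
    by (intro mult_left_mono) auto
  then have "(2 * int t - int l) * int m - (int t)\<^sup>2 * int q * 2 ^ l
    \<le> (2 * int t - int l) * int m - (int t)\<^sup>2 * int q * (\<Sum>j<l. 2 ^ j)" by simp
  also have "\<dots> = (\<Sum>j<l. \<Sum>r<q. (2 * int t - int l) * (2 ^ j * int (length (B j r))) - (int t)\<^sup>2 * 2 ^ j)"
    unfolding m by (simp add: sum_subtractf sum_distrib_left mult_ac)
  also have "\<dots> \<le> (\<Sum>j<l. \<Sum>r<q. weight l j (B j r))"
    by (intro sum_mono weight_ge_linear) auto
  also have "\<dots> = potential l q B"
    unfolding potential_def split by simp
  finally show ?thesis .
qed

section \<open>Counting the unsolved instances\<close>

lemma finite_ksum_instances: "finite (ksum_instances m Q)"
  by (simp add: ksum_instances_def finite_PiE_dflt)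

lemma sum_ksum_instances_Suc:
  "(\<Sum>a\<in>ksum_instances (Suc i) Q. f a) = (\<Sum>a\<in>ksum_instances i Q. \<Sum>x<Q. f (a(i := x)))"
proof -
  have "(\<Sum>a\<in>ksum_instances i Q. \<Sum>x<Q. f (a(i := x))) =
      (\<Sum>(a, x)\<in>ksum_instances i Q \<times> {..<Q}. f (a(i := x)))"
    by (simp add: sum.cartesian_product finite_ksum_instances)
  also have "\<dots> = (\<Sum>a\<in>ksum_instances (Suc i) Q. f a)"
    \<comment> \<open>Instances vanish beyond their length, so dropping the last element has to
      reset entry \<open>i\<close> to 0.\<close>
    by (rule sum.reindex_bij_witness[where i = "\<lambda>a. (a(i := 0), a i)" and j = "\<lambda>(a, x). a(i := x)"])
       (auto simp: ksum_instances_def PiE_dflt_def less_Suc_eq)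
  finally show ?thesis ..
qed

text \<open>A supermartingale argument without probabilities: for every fixed prefix the average
  over the next element does not raise the potential. At level 0 the element in hand carries no
  charge yet.\<close>

lemma sum_potential_process:
  assumes "0 < q"
  shows "(\<Sum>a\<in>ksum_instances i (q ^ l). potential l q (process l q a i)) \<le> 0"
proof (induction i)
  case 0
  have "potential l q (\<lambda>_ _. []) = 0" by (simp add: potential_def bucket_sum_def)
  then show ?case by simp
next
  case (Suc i)
  have "(\<Sum>a\<in>ksum_instances (Suc i) (q ^ l). potential l q (process l q a (Suc i))) =
     (\<Sum>a\<in>ksum_instances i (q ^ l). \<Sum>x<q ^ l. potential l q (insert_node q l 0 (process l q a i) (0 + x) [i]))"
    by (simp add: sum_ksum_instances_Suc process_cong[of i "_(i := _)"])
  also have "\<dots> \<le> (\<Sum>a\<in>ksum_instances i (q ^ l). int (q ^ l) * (potential l q (process l q a i) - int 0 * 2 ^ 0))"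
    using assms by (intro sum_mono sum_potential_insert_node) auto
  also have "\<dots> = int (q ^ l) * (\<Sum>a\<in>ksum_instances i (q ^ l). potential l q (process l q a i))"
    by (simp add: sum_distrib_left)
  also have "\<dots> \<le> 0"
    using Suc.IH by (simp add: mult_le_0_iff)
  finally show ?case .
qed

text \<open>Kept as a product of \<open>2 ^ l * q\<close>, the slightly overcounted weighted number
  of waiting lists, and \<open>2 * q * l\<close>, roughly their average length if no solution
  appears. That average is the point \<open>t\<close> at which the squares are linearised.\<close>

definition num_elements :: "nat \<Rightarrow> nat \<Rightarrow> nat" where
  "num_elements l q = 2 ^ l * q * (2 * q * l)"

text \<open>Markov's inequality by counting. With \<open>t = 2 * q * l\<close> one has
  \<open>m = 2 ^ l * q * t\<close>, so an unsolved instance has potential at least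
  \<open>(t - l) * m\<close>, and every other one at least \<open>- l * m\<close>. As the total is
  at most 0, the unsolved fraction is at most \<open>1 / (2 * q)\<close>, hence at most 1/4.\<close>

lemma card_unsolved:
  assumes "1 \<le> l" "2 \<le> q" and m: "m = num_elements l q"
  defines "I \<equiv> ksum_instances m (q ^ l)"
  shows "4 * card {a \<in> I. process l q a m l 0 = []} \<le> card I"
proof -
  let ?F = "{a \<in> I. process l q a m l 0 = []}"
  let ?pot = "\<lambda>a. potential l q (process l q a m)"
  have fin: "finite I" by (simp add: I_def finite_ksum_instances)
  have valid: "valid_buckets l q a (process l q a m)" if "a \<in> I" for a
    using that assms(2)
    by (intro valid_buckets_process) (auto simp: I_def ksum_instances_def PiE_dflt_def)
  have lv: "leaves l q (process l q a m) = mset [0..<m]" for a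
    using assms(2) by (intro leaves_process) auto
  have lower: "(if a \<in> ?F then 2 * int q * int l * int m else 0) - int l * int m \<le> ?pot a" if "a \<in> I" for a
  proof (cases "a \<in> ?F")
    case True
    have "int m = 2 ^ l * int q * int (2 * q * l)" by (simp add: m num_elements_def)
    then have t: "(int (2 * q * l))\<^sup>2 * int q * 2 ^ l = int (2 * q * l) * int m"
      by (simp only: power2_eq_square mult_ac)
    have "2 * int q * int l * int m - int l * int m =
        (2 * int (2 * q * l) - int l) * int m - (int (2 * q * l))\<^sup>2 * int q * 2 ^ l"
      by (simp only: left_diff_distrib t) simp
    also have "\<dots> \<le> ?pot a"
      using True by (intro potential_ge_unsolved[OF valid[OF that] lv]) auto
    finally show ?thesis using True by simp
  next
    case False
    then show ?thesis
      using potential_ge[OF assms(1) valid[OF that] lv] by (simp only: if_False)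
  qed
  have "int (card ?F) * (2 * int q * int l * int m) - int (card I) * (int l * int m)
     = (\<Sum>a\<in>I. (if a \<in> ?F then 2 * int q * int l * int m else 0) - int l * int m)"
    using fin by (simp add: sum_subtractf sum.If_cases Int_def)
  also have "\<dots> \<le> (\<Sum>a\<in>I. ?pot a)"
    by (intro sum_mono lower)
  also have "\<dots> \<le> 0"
    unfolding I_def using assms(2) by (intro sum_potential_process) auto
  finally have "(int (card ?F) * (2 * int q)) * (int l * int m) \<le> int (card I) * (int l * int m)"
    by (simp add: mult_ac)
  moreover have "0 < int l * int m" using assms(1,2) by (simp add: m num_elements_def)
  ultimately have "int (card ?F) * (2 * int q) \<le> int (card I)"
    by (simp only: mult_le_cancel_right_pos)
  moreover have "int (card ?F) * 4 \<le> int (card ?F) * (2 * int q)"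
    using assms(2) by (intro mult_left_mono) auto
  ultimately show ?thesis by linarith
qed

lemma prob_solved:
  assumes "1 \<le> l" "2 \<le> q" "m = num_elements l q"
  shows "measure_pmf.prob (ksum_dist m (q ^ l)) {a. process l q a m l 0 \<noteq> []} \<ge> 3 / 4"
proof -
  let ?I = "ksum_instances m (q ^ l)"
  let ?F = "{a \<in> ?I. process l q a m l 0 = []}"
  have I: "ksum_dist m (q ^ l) = pmf_of_set ?I"
    unfolding ksum_dist_def ksum_instances_def using assms(2)
    by (intro Pi_pmf_of_set) (auto simp: lessThan_empty_iff)
  have ne: "?I \<noteq> {}"
    using set_pmf_not_empty[of "ksum_dist m (q ^ l)"] assms(2)
    unfolding ksum_dist_def ksum_instances_def
    by (subst (asm) set_Pi_pmf) (auto simp: PiE_dflt_def fun_eq_iff intro!: exI[of _ "\<lambda>_. 0"])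
  have "card ?I = card ?F + card (?I \<inter> {a. process l q a m l 0 \<noteq> []})"
    by (subst card_Un_disjoint[symmetric]) (auto simp: finite_ksum_instances intro!: arg_cong[where f = card])
  then have "3 * card ?I \<le> 4 * card (?I \<inter> {a. process l q a m l 0 \<noteq> []})"
    using card_unsolved[OF assms] assms(3) by simp
  then have "3 * real (card ?I) \<le> 4 * real (card (?I \<inter> {a. process l q a m l 0 \<noteq> []}))"
    by (metis of_nat_le_iff of_nat_mult of_nat_numeral)
  moreover have "0 < card ?I" using ne by (simp add: card_gt_0_iff finite_ksum_instances)
  ultimately show ?thesis
    unfolding I by (simp add: measure_pmf_of_set[OF ne finite_ksum_instances] field_simps)
qed

section \<open>The program and its memory layout\<close>

text \<open>The index of the invariant counts the iterations still to come, so it serves as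
  termination measure and time bound at once. The extra \<open>C\<close> pays for the last, failing
  test.\<close>

lemma exec_While_count:
  assumes "\<And>n s. Inv (Suc n) s \<Longrightarrow> val e s \<noteq> 0 \<and> (\<exists>t\<le>D. \<exists>s'. exec P s t s' \<and> Inv n s')"
    and "\<And>s. Inv 0 s \<Longrightarrow> val e s = 0"
    and "\<And>n s. Inv n s \<Longrightarrow> cost e s \<le> C"
  shows "Inv n s \<Longrightarrow> \<exists>t\<le>n * (C + D) + C. \<exists>s'. exec (While e P) s t s' \<and> Inv 0 s'"
proof (induction n arbitrary: s)
  case 0
  then have "exec (While e P) s (cost e s) s" using assms(2) by (intro exec.WhileFalse)
  then show ?case using assms(3)[OF 0] 0 unfolding mult_0 add_0 by blast
next
  case (Suc n)
  then obtain t1 s1 where 1: "val e s \<noteq> 0" "t1 \<le> D" "exec P s t1 s1" "Inv n s1"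
    using assms(1) by blast
  obtain t2 s2 where 2: "t2 \<le> n * (C + D) + C" "exec (While e P) s1 t2 s2" "Inv 0 s2"
    using Suc.IH[OF 1(4)] by blast
  have "exec (While e P) s (cost e s + t1 + t2) s2"
    using 1 2 by (intro exec.WhileTrue)
  moreover have "cost e s + t1 + t2 \<le> Suc n * (C + D) + C"
    using 1(2) 2(1) assms(3)[OF Suc.prems] by simp
  ultimately show ?case using 2(3) by blast
qed

text \<open>
  Cell \<open>i < m\<close> holds an input element, later the value of the node whose last index is \<open>i\<close>. For
  that node, cell \<open>2 m + i\<close> holds its first index and cell \<open>3 m + i\<close> the link to the next node of
  its bucket; cell \<open>m + i\<close> holds the successor of \<open>i\<close> in its index list. The top of bucket \<open>(j, r)\<close>
  is in cell \<open>4 m + j q + r\<close>. Tops and links are stored as index plus one, \<open>0\<close> meaning none.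
  The output phase reuses \<open>j_reg\<close> as the output address, \<open>addr_reg\<close> as the current index and
  \<open>p_reg\<close> as the number of indices still to be written.
\<close>

abbreviation "l_reg \<equiv> Reg 0"
abbreviation "q_reg \<equiv> Reg 1"
abbreviation "m_reg \<equiv> Reg 2"
abbreviation "i_reg \<equiv> Reg 3"
abbreviation "j_reg \<equiv> Reg 4"
abbreviation "v_reg \<equiv> Reg 5"
abbreviation "head_reg \<equiv> Reg 6"
abbreviation "active_reg \<equiv> Reg 7"
abbreviation "found_reg \<equiv> Reg 8"
abbreviation "addr_reg \<equiv> Reg 9"
abbreviation "p_reg \<equiv> Reg 10"

definition array :: "nat \<Rightarrow> expr \<Rightarrow> expr" where
  "array k e = Op Add (Op Mul (Const k) m_reg) e"

definition bucket_expr :: "expr \<Rightarrow> expr" where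
  "bucket_expr e = array 4 (Op Add (Op Mul j_reg q_reg) e)"

definition start_element :: prog where
  "start_element =
     Seq (SetReg 5 (Load i_reg)) (Seq (SetReg 6 i_reg) (Seq (SetReg 4 (Const 0)) (SetReg 7 (Const 1))))"

definition finish_element :: prog where
  "finish_element =
     Seq (Store i_reg v_reg) (Seq (Store (array 2 i_reg) head_reg) (SetReg 7 (Const 0)))"

text \<open>Concatenates two index lists in constant time: the last index of the popped node gets
  the first index in hand as successor. This is why nodes are addressed by their last index, which
  for the node in hand is always \<open>i\<close>, and why the successor cell of a last index is
  otherwise left unspecified.\<close>

definition pop_node :: prog where
  "pop_node =
     Seq (SetReg 10 (Op Sub (Load addr_reg) (Const 1)))
    (Seq (Store addr_reg (Load (array 3 p_reg)))
    (Seq (SetReg 5 (Op Div (Op Add (Load p_reg) v_reg) q_reg))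
    (Seq (Store (array 1 p_reg) head_reg)
    (Seq (SetReg 6 (Load (array 2 p_reg)))
         (SetReg 4 (Op Add j_reg (Const 1)))))))"

definition push_node :: prog where
  "push_node =
     Seq (SetReg 9 (bucket_expr (Op Mod v_reg q_reg)))
    (Seq (Store (array 3 i_reg) (Load addr_reg))
    (Seq (Store addr_reg (Op Add i_reg (Const 1)))
         finish_element))"

definition insert_step :: prog where
  "insert_step =
     Cond (Op Sub l_reg j_reg)
       (Seq (SetReg 9 (bucket_expr (Op Mod (Op Sub q_reg (Op Mod v_reg q_reg)) q_reg)))
            (Cond (Load addr_reg) pop_node push_node))
       (Seq (SetReg 8 i_reg) finish_element)"

definition next_element :: prog where
  "next_element = SetReg 3 (Op Add i_reg (Const 1))"

definition process_element :: prog where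
  "process_element = Seq start_element (Seq (While active_reg insert_step) next_element)"

definition start_output :: prog where
  "start_output = Seq (SetReg 9 (Load (array 2 found_reg))) (Seq (SetReg 10 (Const 1)) (SetReg 4 (Const 0)))"

text \<open>The solution size \<open>2 ^ l\<close> is not among the parameters and is built by
  doubling, with register 0 counting down.\<close>

definition double_length :: prog where
  "double_length = Seq (SetReg 10 (Op Add p_reg p_reg)) (SetReg 0 (Op Sub l_reg (Const 1)))"

definition emit_index :: prog where
  "emit_index =
     Seq (Store j_reg addr_reg)
    (Seq (SetReg 9 (Load (array 1 addr_reg)))
    (Seq (SetReg 4 (Op Add j_reg (Const 1)))
         (SetReg 10 (Op Sub p_reg (Const 1)))))"

definition ksum_prog :: prog where
  "ksum_prog =
     Seq (While (Op Sub m_reg i_reg) process_element)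
    (Seq start_output
    (Seq (While l_reg double_length)
         (While p_reg emit_index)))"

definition straight_line :: "prog set" where
  "straight_line = {start_element, insert_step, next_element, start_output, double_length, emit_index}"

definition loop_tests :: "expr set" where
  "loop_tests = {active_reg, Op Sub m_reg i_reg, l_reg, p_reg}"

lemmas prog_defs = array_def bucket_expr_def start_element_def finish_element_def pop_node_def
  push_node_def insert_step_def next_element_def start_output_def double_length_def emit_index_def

text \<open>Finitely many blocks and tests occur, so their individual constants can be summed into a
  single one.\<close>

lemma straight_line_cost:
  "\<exists>K. \<forall>X\<ge>2. \<forall>s. bounded_state X s \<longrightarrow>
     (\<forall>P\<in>straight_line. \<exists>t\<le>K * (len X)\<^sup>2. exec P s t (sem P s)) \<and>
     (\<forall>e\<in>loop_tests. cost e s \<le> K * (len X)\<^sup>2)"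
proof -
  have "\<exists>K. \<forall>X\<ge>2. \<forall>s. bounded_state X s \<longrightarrow> (\<exists>t\<le>K * (len X)\<^sup>2. exec P s t (sem P s))"
    if "P \<in> straight_line" for P
  proof -
    have "loopfree P" using that by (auto simp: straight_line_def prog_defs)
    from exec_loopfree[OF this] show ?thesis by blast
  qed
  then obtain K1 where K1: "\<And>P X s. P \<in> straight_line \<Longrightarrow> 2 \<le> X \<Longrightarrow> bounded_state X s \<Longrightarrow>
      \<exists>t\<le>K1 P * (len X)\<^sup>2. exec P s t (sem P s)" by metis
  obtain K2 where K2: "\<And>e X s. 2 \<le> X \<Longrightarrow> bounded_state X s \<Longrightarrow> cost e s \<le> K2 e * (len X)\<^sup>2"
    using cost_le by metis
  define K where "K = (\<Sum>P\<in>straight_line. K1 P) + (\<Sum>e\<in>loop_tests. K2 e)"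
  have "K1 P \<le> K" if "P \<in> straight_line" for P
    using member_le_sum[OF that, of K1] by (simp add: K_def straight_line_def)
  then have "K1 P * n \<le> K * n" if "P \<in> straight_line" for P n using that by simp
  moreover have "K2 e \<le> K" if "e \<in> loop_tests" for e
    using member_le_sum[OF that, of K2] by (simp add: K_def loop_tests_def)
  then have "K2 e * n \<le> K * n" if "e \<in> loop_tests" for e n using that by simp
  ultimately show ?thesis using K1 K2 by (intro exI[of _ K]) (meson le_trans)
qed

section \<open>Linked-list representation of the buckets\<close>

definition node_repr :: "nat \<Rightarrow> (nat \<Rightarrow> nat) \<Rightarrow> node \<Rightarrow> bool" where
  "node_repr m M = (\<lambda>(v, is). is \<noteq> [] \<and> M (last is) = v \<and> M (2 * m + last is) = hd is \<and>
     successively (\<lambda>x y. M (m + x) = y) is)"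

fun stack_repr :: "nat \<Rightarrow> (nat \<Rightarrow> nat) \<Rightarrow> nat \<Rightarrow> node list \<Rightarrow> bool" where
  "stack_repr m M x [] \<longleftrightarrow> x = 0"
| "stack_repr m M x (n # ns) \<longleftrightarrow> x = Suc (last (snd n)) \<and> node_repr m M n \<and>
     stack_repr m M (M (3 * m + last (snd n))) ns"

definition bucket_addr :: "nat \<Rightarrow> nat \<Rightarrow> nat \<Rightarrow> nat \<Rightarrow> nat" where
  "bucket_addr q m j r = 4 * m + (j * q + r)"

lemma bucket_addr_inject:
  assumes "r < q" "r' < q"
  shows "bucket_addr q m j r = bucket_addr q m j' r' \<longleftrightarrow> j = j' \<and> r = r'"
proof -
  have "(j * q + r) div q = j" "(j' * q + r') div q = j'" using assms by auto
  then show ?thesis by (auto simp: bucket_addr_def)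
qed

lemma bucket_addr_neq: "x < m \<Longrightarrow> k < 4 \<Longrightarrow> bucket_addr q m j r \<noteq> k * m + x"
proof -
  assume "x < m" "k < 4"
  then have "k * m \<le> 3 * m" by (intro mult_right_mono) auto
  with \<open>x < m\<close> show ?thesis unfolding bucket_addr_def by linarith
qed

text \<open>Level \<open>l\<close> has no bucket in memory: register \<open>f\<close> only remembers its latest node.\<close>

definition heap_repr :: "nat \<Rightarrow> nat \<Rightarrow> nat \<Rightarrow> nat \<Rightarrow> (nat \<Rightarrow> nat) \<Rightarrow> buckets \<Rightarrow> bool" where
  "heap_repr l q m f M B \<longleftrightarrow>
     (\<forall>j<l. \<forall>r<q. stack_repr m M (M (bucket_addr q m j r)) (B j r)) \<and>
     (\<forall>n ns. B l 0 = n # ns \<longrightarrow> node_repr m M n \<and> f = last (snd n))"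

text \<open>A frame condition by ownership: index \<open>x\<close> owns the four cells
  \<open>k * m + x\<close>. Since every index lies in at most one node, disjointness of index
  multisets replaces reasoning about separate heap regions.\<close>

definition agree :: "nat \<Rightarrow> nat multiset \<Rightarrow> (nat \<Rightarrow> nat) \<Rightarrow> (nat \<Rightarrow> nat) \<Rightarrow> bool" where
  "agree m S M M' \<longleftrightarrow> (\<forall>x. x \<in># S \<longrightarrow> (\<forall>k<4. M' (k * m + x) = M (k * m + x)))"

lemma agreeD:
  assumes "agree m S M M'" "x \<in># S"
  shows "M' x = M x" "M' (m + x) = M (m + x)" "M' (2 * m + x) = M (2 * m + x)"
    "M' (3 * m + x) = M (3 * m + x)"
proof -
  have "M' (k * m + x) = M (k * m + x)" if "k < 4" for k
    using assms that by (auto simp: agree_def)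
  from this[of 0] this[of 1] this[of 2] this[of 3]
  show "M' x = M x" "M' (m + x) = M (m + x)" "M' (2 * m + x) = M (2 * m + x)"
    "M' (3 * m + x) = M (3 * m + x)" by simp_all
qed

lemma agree_mono: "agree m S M M' \<Longrightarrow> S' \<subseteq># S \<Longrightarrow> agree m S' M M'"
  unfolding agree_def by (meson mset_subset_eqD)

lemma node_repr_agree:
  assumes "agree m (mset (snd n)) M M'" "node_repr m M n"
  shows "node_repr m M' n"
proof -
  obtain v "is" where n: "n = (v, is)" by force
  have "last is \<in># mset is" using assms(2) by (simp add: node_repr_def n)
  moreover have "successively (\<lambda>x y. M' (m + x) = y) is"
    by (rule successively_mono[where P = "\<lambda>x y. M (m + x) = y"])
       (use assms agreeD(2)[OF assms(1)] in \<open>auto simp: node_repr_def n\<close>)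
  ultimately show ?thesis
    using assms(2) agreeD[OF assms(1)] by (simp add: node_repr_def n)
qed

lemma stack_repr_agree:
  assumes "agree m (node_leaves j ns) M M'" "stack_repr m M x ns"
  shows "stack_repr m M' x ns"
  using assms
proof (induction ns arbitrary: x)
  case (Cons n ns)
  have "agree m (mset (snd n)) M M'" "agree m (node_leaves j ns) M M'"
    using Cons.prems(1) by (auto simp: agree_def node_leaves_def)
  moreover have "last (snd n) \<in># mset (snd n)"
    using Cons.prems(2) by (auto simp: node_repr_def split: prod.splits)
  then have "M' (3 * m + last (snd n)) = M (3 * m + last (snd n))"
    using calculation(1) by (intro agreeD(4))
  ultimately show ?case
    using Cons by (auto intro: node_repr_agree)
qed simp

lemma leaves_upd:
  assumes "j \<le> l" "r < q"
  shows "leaves l q (upd B j r ns) = leaves l q (upd B j r []) + node_leaves j ns"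
proof -
  have "upd (upd B j r []) j r ns = upd B j r ns" by (simp add: upd_def)
  then show ?thesis
    using bucket_sum_upd[OF assms, of node_leaves "upd B j r []" ns]
    by (simp add: leaves_def upd_apply node_leaves_def)
qed

lemma node_leaves_subset:
  assumes "j \<le> l" "r < q"
  shows "node_leaves j (B j r) \<subseteq># leaves l q B"
proof -
  have "upd B j r (B j r) = B" by (simp add: upd_def)
  then show ?thesis using leaves_upd[OF assms, of B "B j r"] by simp
qed

text \<open>\<open>upd B j r []\<close> contains exactly the indices outside the bucket being
  changed. Their cells must survive, while the changed bucket is established anew by the last
  assumption.\<close>

lemma heap_repr_upd:
  assumes "heap_repr l q m f M B" "j < l" "r < q"
    and agree: "agree m (leaves l q (upd B j r [])) M M'"
    and "\<And>j' r'. j' < l \<Longrightarrow> r' < q \<Longrightarrow> (j', r') \<noteq> (j, r) \<Longrightarrow>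
      M' (bucket_addr q m j' r') = M (bucket_addr q m j' r')"
    and "stack_repr m M' (M' (bucket_addr q m j r)) ns"
  shows "heap_repr l q m f M' (upd B j r ns)"
  unfolding heap_repr_def
proof (intro conjI allI impI)
  have sub: "agree m (node_leaves j' (B j' r')) M M'" if "j' \<le> l" "r' < q" "(j', r') \<noteq> (j, r)" for j' r'
    using node_leaves_subset[OF that(1,2), of "upd B j r []"] that(3)
    by (intro agree_mono[OF agree]) (auto simp: upd_apply split: if_splits)
  {
    fix j' r' assume *: "j' < l" "r' < q"
    show "stack_repr m M' (M' (bucket_addr q m j' r')) (upd B j r ns j' r')"
    proof (cases "(j', r') = (j, r)")
      case True
      then show ?thesis using assms(6) by (simp add: upd_apply)
    next
      case False
      have "stack_repr m M (M (bucket_addr q m j' r')) (B j' r')"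
        using assms(1) * by (simp add: heap_repr_def)
      then show ?thesis
        using stack_repr_agree[OF sub[OF _ _ False]] False assms(5)[OF * False] *
        by (auto simp: upd_apply)
    qed
  next
    fix n ns' assume "upd B j r ns l 0 = n # ns'"
    then have n: "B l 0 = n # ns'" using assms(2) by (simp add: upd_apply)
    then have "agree m (mset (snd n)) M M'"
      using sub[of l 0] assms(2,3) by (auto simp: agree_def node_leaves_def)
    then show "node_repr m M' n" "f = last (snd n)"
      using assms(1) n node_repr_agree by (auto simp: heap_repr_def)
  }
qed

lemma heap_repr_finish:
  assumes "heap_repr l q m f M B" "agree m (leaves l q B) M M'"
    and "\<And>j' r'. j' < l \<Longrightarrow> r' < q \<Longrightarrow> M' (bucket_addr q m j' r') = M (bucket_addr q m j' r')"
    and "node_repr m M' (v, is)"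
  shows "heap_repr l q m (last is) M' (upd B l 0 ((v, is) # B l 0))"
  unfolding heap_repr_def
proof (intro conjI allI impI)
  fix j r assume *: "j < l" "r < q"
  have "agree m (node_leaves j (B j r)) M M'"
    using node_leaves_subset[of j l r q B] * by (intro agree_mono[OF assms(2)]) auto
  then show "stack_repr m M' (M' (bucket_addr q m j r)) (upd B l 0 ((v, is) # B l 0) j r)"
    using assms(1,3) * by (auto simp: heap_repr_def upd_apply intro: stack_repr_agree)
qed (use assms(4) in \<open>auto simp: upd_apply\<close>)

section \<open>Simulation of an insertion\<close>

text \<open>\<open>X\<close> bounds every register and cell of the run, and \<open>C\<close> is the
  resulting price of one block or test, so the simulation only counts steps. The assumption
  \<open>2 ^ l \<le> m\<close> makes the output fit into the value cells, below all links.\<close>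

locale ksum_ram =
  fixes l q m X C :: nat
  assumes l: "1 \<le> l" and q: "2 \<le> q" and m: "2 ^ l \<le> m"
    and X: "5 * m + l * q \<le> X" "q ^ l \<le> X"
    and exec_straight_line: "\<And>P s. P \<in> straight_line \<Longrightarrow> bounded_state X s \<Longrightarrow> \<exists>t\<le>C. exec P s t (sem P s)"
    and cost_test: "\<And>e s. e \<in> loop_tests \<Longrightarrow> bounded_state X s \<Longrightarrow> cost e s \<le> C"
begin

abbreviation "addr \<equiv> bucket_addr q m"

lemma m_pos: "0 < m"
  by (rule less_le_trans[OF _ m]) simp

lemma l_less_X: "l < X"
proof -
  have "l * 1 \<le> l * q" using q by (intro mult_left_mono) auto
  then show ?thesis using X m_pos by linarith
qed

lemma addr_less:
  assumes "j < l" "r < q"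
  shows "addr j r \<le> X"
proof -
  have "j * q + r < Suc j * q" using assms by simp
  also have "\<dots> \<le> l * q" using assms by (intro mult_right_mono) auto
  finally show ?thesis using X by (simp add: bucket_addr_def)
qed

lemma bounded_upd:
  assumes "bounded_state X (R, M)" "x \<le> X"
  shows "bounded_state X (R(r := x), M)" "bounded_state X (R, M(c := x))"
  using assms by (auto simp: bounded_state_def)

lemma cell_neq:
  assumes "x < m" "y < m" "x \<noteq> y"
  shows "k * m + x \<noteq> k' * m + y"
proof
  assume "k * m + x = k' * m + y"
  then have "(k * m + x) mod m = (k' * m + y) mod m" by simp
  then show False using assms by simp
qed

lemma agree_upd:
  assumes "agree m S M M'" "\<And>x. x \<in># S \<Longrightarrow> x < m"
  shows "y < m \<Longrightarrow> y \<notin># S \<Longrightarrow> c \<in> {y, m + y, 2 * m + y, 3 * m + y} \<Longrightarrow> agree m S M (M'(c := z))"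
    and "agree m S M (M'(addr j r := z))"
proof -
  assume y: "y < m" "y \<notin># S" "c \<in> {y, m + y, 2 * m + y, 3 * m + y}"
  then have "c = 0 * m + y \<or> c = 1 * m + y \<or> c = 2 * m + y \<or> c = 3 * m + y" by auto
  then obtain k where c: "c = k * m + y" by blast
  have "k' * m + x \<noteq> c" if "x \<in># S" for k' x
    unfolding c by (rule cell_neq) (use that y assms(2) in auto)
  then show "agree m S M (M'(c := z))" using assms(1) by (simp add: agree_def)
next
  have "k * m + x \<noteq> addr j r" if "x \<in># S" "k < 4" for k x
    using bucket_addr_neq[of x m k q j r] that assms(2) by auto
  then show "agree m S M (M'(addr j r := z))" using assms(1) by (simp add: agree_def)
qed

lemma agree_refl: "agree m S M M"
  by (simp add: agree_def)

lemma addr_neq_cell: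
  "y < m \<Longrightarrow> c \<in> {y, m + y, 2 * m + y, 3 * m + y} \<Longrightarrow> addr j r \<noteq> c"
  unfolding bucket_addr_def by auto

lemma successively_update:
  assumes "successively (\<lambda>x y. M (m + x) = y) xs" "\<And>x. x \<in> set xs \<Longrightarrow> M' (m + x) = M (m + x)"
  shows "successively (\<lambda>x y. M' (m + x) = y) xs"
  using assms(1) by (rule successively_mono) (use assms(2) in simp)

text \<open>The multiset equation says that the indices in hand are disjoint from the stored ones
  and exhaust the elements read so far. Writing to their cells therefore disturbs no bucket.\<close>

definition inserting where
  "inserting a i j v is B R M \<longleftrightarrow>
     R 0 = l \<and> R 1 = q \<and> R 2 = m \<and> R 3 = i \<and> R 4 = j \<and> R 5 = v \<and> R 6 = hd is \<and> R 7 = 1 \<and>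
     i < m \<and> j \<le> l \<and> is \<noteq> [] \<and> last is = i \<and> successively (\<lambda>x y. M (m + x) = y) is \<and>
     leaves l q B + mset is = mset [0..<Suc i] \<and> heap_repr l q m (R 8) M B \<and>
     valid_buckets l q a B \<and> partial_sol l q a j v is \<and> bounded_state X (R, M)"

definition inserted where
  "inserted i B R M \<longleftrightarrow>
     R 0 = l \<and> R 1 = q \<and> R 2 = m \<and> R 3 = i \<and> R 7 = 0 \<and> heap_repr l q m (R 8) M B \<and>
     bounded_state X (R, M)"

lemma not_in_rest:
  assumes "A + mset is = mset xs" "distinct xs" "x \<in># A"
  shows "x \<notin> set is"
proof -
  obtain ys where ys: "mset ys = A" using ex_mset by blast
  then have "mset (ys @ is) = mset xs" using assms(1) by simp
  then have "distinct (ys @ is)" using assms(2) mset_eq_imp_distinct_iff[of "ys @ is" xs] by simp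
  then show ?thesis using assms(3) ys by auto
qed

lemma inserting_leaf:
  assumes "inserting a i j v is B R M"
  shows "x \<in># leaves l q B \<Longrightarrow> x < m \<and> x \<noteq> i" "set is \<subseteq> {..<m}" "v < q ^ l"
proof -
  have eq: "leaves l q B + mset is = mset [0..<Suc i]" and "i < m" "last is = i" "is \<noteq> []"
    using assms unfolding inserting_def by blast+
  then have i: "i < m" "i \<in> set is" using last_in_set by auto
  have "set_mset (leaves l q B + mset is) = {0..<Suc i}" unfolding eq set_mset_mset by (rule set_upt)
  then have "set_mset (leaves l q B) \<union> set is = {0..<Suc i}"
    unfolding set_mset_union set_mset_mset .
  then have sub: "x < Suc i" if "x \<in># leaves l q B \<or> x \<in> set is" for x
    using that by (metis Un_iff atLeastLessThan_iff)
  then show "set is \<subseteq> {..<m}" using i by fastforce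
  {
    assume "x \<in># leaves l q B"
    then have "x < Suc i" using sub by simp
    moreover have "x \<noteq> i" using not_in_rest[OF eq, of x] i \<open>x \<in># leaves l q B\<close> by auto
    ultimately show "x < m \<and> x \<noteq> i" using i by auto
  }
  show "v < q ^ l" using assms by (simp add: inserting_def partial_sol_def)
qed

lemma inserting_bounded:
  assumes "inserting a i j v is B R M"
  shows "Suc i \<le> X" "v \<le> X" "hd is \<le> X" "M c \<le> X"
proof -
  show "Suc i \<le> X" using assms X(1) by (simp add: inserting_def)
  show "v \<le> X" using inserting_leaf(3)[OF assms] X(2) by simp
  have "bounded_state X (R, M)" "R 6 = hd is" using assms unfolding inserting_def by blast+
  then have "fst (R, M) 6 \<le> X" unfolding bounded_state_def by blast
  then show "hd is \<le> X" using \<open>R 6 = hd is\<close> by simp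
  show "M c \<le> X" using assms by (simp add: inserting_def bounded_state_def)
qed

lemma insert_step_finish:
  assumes ins: "inserting a i j v is B R M" and "j = l"
  shows "case sem insert_step (R, M) of (R', M') \<Rightarrow>
    inserted i (insert_node q 0 j B v is) R' M' \<and> (\<forall>k. i < k \<and> k < m \<longrightarrow> M' k = M k)"
proof -
  note I = ins[unfolded inserting_def]
  then have chain: "successively (\<lambda>x y. M (m + x) = y) is" by blast
  let ?M = "M(i := v, 2 * m + i := hd is)"
  have sem: "sem insert_step (R, M) = (R(8 := i, 7 := 0), ?M)"
    using I assms(2) by (simp add: prog_defs)
  note bd = inserting_bounded[OF ins]
  have "node_repr m ?M (v, is)"
  proof -
    have "m + x \<noteq> i" "m + x \<noteq> 2 * m + i" if "x \<in> set is" for x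
      using that inserting_leaf(2)[OF ins] I by auto
    then have "?M (m + x) = M (m + x)" if "x \<in> set is" for x using that by simp
    then have "successively (\<lambda>x y. ?M (m + x) = y) is"
      by (rule successively_update[OF chain])
    then show ?thesis using I by (auto simp: node_repr_def)
  qed
  moreover have "agree m (leaves l q B) M ?M"
    using I inserting_leaf(1)[OF ins] by (intro agree_upd[of _ _ _ i] agree_refl) auto
  moreover have "?M (addr j' r') = M (addr j' r')" for j' r'
    using I addr_neq_cell[of i _ j' r'] by simp
  ultimately have "heap_repr l q m (last is) ?M (upd B l 0 ((v, is) # B l 0))"
    using I by (intro heap_repr_finish) auto
  then show ?thesis
    using I assms(2) bd by (auto simp: sem inserted_def intro!: bounded_upd)
qed

lemma insert_step_push:
  assumes ins: "inserting a i j v is B R M" and "j < l"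
    and empty: "B j ((q - v mod q) mod q) = []"
  shows "case sem insert_step (R, M) of (R', M') \<Rightarrow>
    inserted i (insert_node q (Suc n) j B v is) R' M' \<and> (\<forall>k. i < k \<and> k < m \<longrightarrow> M' k = M k)"
proof -
  note I = ins[unfolded inserting_def]
  then have chain: "successively (\<lambda>x y. M (m + x) = y) is" by blast
  let ?r = "v mod q"
  let ?M = "M(3 * m + i := M (addr j ?r), addr j ?r := Suc i, i := v, 2 * m + i := hd is)"
  have r: "?r < q" "(q - ?r) mod q < q" using q by auto
  have "stack_repr m M (M (addr j ((q - ?r) mod q))) (B j ((q - ?r) mod q))"
    using I assms(2) r by (simp add: heap_repr_def)
  then have "M (addr j ((q - ?r) mod q)) = 0" using empty by simp
  then have sem: "sem insert_step (R, M) = (R(9 := addr j ?r, 7 := 0), ?M)"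
    using I assms(2) by (simp add: prog_defs bucket_addr_def)
  note bd = inserting_bounded[OF ins] addr_less[OF assms(2) r(1)]
  have neq: "addr j' r' \<noteq> i" "addr j' r' \<noteq> 2 * m + i" "addr j' r' \<noteq> 3 * m + i" for j' r'
    using I addr_neq_cell[of i _ j' r'] by auto
  have agree: "agree m (leaves l q B) M ?M"
    using I inserting_leaf(1)[OF ins]
    by (intro agree_upd(1)[of _ _ _ i] agree_upd(2) agree_refl) auto
  have "node_repr m ?M (v, is)"
  proof -
    have "m + x \<noteq> i" "m + x \<noteq> 2 * m + i" "m + x \<noteq> 3 * m + i" "m + x \<noteq> addr j ?r" if "x \<in> set is" for x
      using that inserting_leaf(2)[OF ins] I addr_neq_cell[of x "m + x"] by fastforce+
    then have "?M (m + x) = M (m + x)" if "x \<in> set is" for x using that by simp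
    then have "successively (\<lambda>x y. ?M (m + x) = y) is"
      by (rule successively_update[OF chain])
    then show ?thesis using I by (auto simp: node_repr_def)
  qed
  moreover have "stack_repr m ?M (M (addr j ?r)) (B j ?r)"
  proof (rule stack_repr_agree)
    show "agree m (node_leaves j (B j ?r)) M ?M"
      using node_leaves_subset[of j l ?r q B] assms(2) r by (intro agree_mono[OF agree]) auto
    show "stack_repr m M (M (addr j ?r)) (B j ?r)"
      using I assms(2) r by (simp add: heap_repr_def)
  qed
  ultimately have "stack_repr m ?M (?M (addr j ?r)) ((v, is) # B j ?r)"
    using I neq m_pos neq[symmetric] by simp
  moreover have "agree m (leaves l q (upd B j ?r [])) M ?M"
    using leaves_upd[of j l ?r q B "B j ?r"] assms(2) r
    by (intro agree_mono[OF agree]) (auto simp: upd_def)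
  moreover have "?M (addr j' r') = M (addr j' r')" if "r' < q" "(j', r') \<noteq> (j, ?r)" for j' r'
    using neq[of j' r'] bucket_addr_inject[OF that(1) r(1), of m j' j] that(2) by auto
  ultimately have "heap_repr l q m (R 8) ?M (upd B j ?r ((v, is) # B j ?r))"
    using I assms(2) r by (intro heap_repr_upd[of l q m "R 8" M B]) auto
  then show ?thesis
    using I empty bd neq by (auto simp: sem inserted_def bucket_addr_def intro!: bounded_upd)
qed

lemma insert_step_pop:
  assumes ins: "inserting a i j v is B R M" and "j < l"
    and top: "B j ((q - v mod q) mod q) = (w, js) # ns"
  shows "case sem insert_step (R, M) of (R', M') \<Rightarrow>
    inserting a i (Suc j) ((w + v) div q) (js @ is) (upd B j ((q - v mod q) mod q) ns) R' M' \<and>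
    (\<forall>k<m. M' k = M k)"
proof -
  note I = ins[unfolded inserting_def]
  then have chain: "successively (\<lambda>x y. M (m + x) = y) is" by blast
  let ?r = "(q - v mod q) mod q" let ?B = "upd B j ?r ns"
  define p where "p = last js"
  let ?M = "M(addr j ?r := M (3 * m + p), m + p := hd is)"
  have r: "?r < q" using q by auto
  have "stack_repr m M (M (addr j ?r)) ((w, js) # ns)"
    using I assms(2) r by (simp add: heap_repr_def flip: top)
  then have st: "M (addr j ?r) = Suc p" "node_repr m M (w, js)" "stack_repr m M (M (3 * m + p)) ns"
    by (auto simp: p_def)
  then have node: "js \<noteq> []" "M p = w" "M (2 * m + p) = hd js" "successively (\<lambda>x y. M (m + x) = y) js"
    by (auto simp: node_repr_def p_def)
  have lv: "leaves l q B = leaves l q ?B + mset js"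
    by (rule leaves_pop) (use assms(2) r top in auto)
  have sub: "x \<in> set js \<Longrightarrow> x \<in># leaves l q B" for x unfolding lv by simp
  have p: "p \<in> set js" using node(1) by (simp add: p_def)
  have pm: "p < m" using inserting_leaf(1)[OF ins sub[OF p]] by simp
  have eq: "leaves l q ?B + mset (js @ is) = mset [0..<Suc i]"
    using I lv by (simp add: add.assoc)
  have dist: "distinct (js @ is)"
  proof -
    obtain ys where "mset ys = leaves l q ?B" using ex_mset by blast
    then have "mset (ys @ js @ is) = mset [0..<Suc i]" using eq by simp
    then have "distinct (ys @ js @ is)"
      using mset_eq_imp_distinct_iff[of "ys @ js @ is" "[0..<Suc i]"] distinct_upt by blast
    then show ?thesis by simp
  qed
  have rest: "x < m" "x \<noteq> p" if "x \<in># leaves l q ?B" for x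
  proof -
    show "x < m" using inserting_leaf(1)[OF ins, of x] that by (simp add: lv)
    show "x \<noteq> p" using not_in_rest[OF eq distinct_upt that] p by auto
  qed
  have neq: "addr j' r' \<noteq> p" "addr j' r' \<noteq> m + p" "addr j' r' \<noteq> 2 * m + p" "addr j' r' \<noteq> 3 * m + p" for j' r'
    using pm addr_neq_cell[of p _ j' r'] by auto
  let ?R = "R(9 := addr j ?r, 10 := p, 5 := (w + v) div q, 6 := hd js, 4 := Suc j)"
  have sem: "sem insert_step (R, M) = (?R, ?M)"
    using I assms(2) st(1) node(2,3) neq[of j ?r] pm m_pos
    by (simp add: prog_defs bucket_addr_def)
  have agree: "agree m (leaves l q ?B) M ?M"
    using rest pm by (intro agree_upd(1)[of _ _ _ p] agree_upd(2) agree_refl) auto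
  have "stack_repr m ?M (M (3 * m + p)) ns"
  proof (rule stack_repr_agree[OF _ st(3)])
    show "agree m (node_leaves j ns) M ?M"
      using node_leaves_subset[of j l ?r q ?B] assms(2) r
      by (intro agree_mono[OF agree]) (auto simp: upd_apply)
  qed
  then have "stack_repr m ?M (?M (addr j ?r)) ns" using neq by simp
  moreover have "agree m (leaves l q (upd B j ?r [])) M ?M"
    using leaves_upd[of j l ?r q B ns] assms(2) r by (intro agree_mono[OF agree]) auto
  moreover have "?M (addr j' r') = M (addr j' r')" if "r' < q" "(j', r') \<noteq> (j, ?r)" for j' r'
    using neq[of j' r'] bucket_addr_inject[OF that(1) r, of m j' j] that(2) by auto
  ultimately have heap: "heap_repr l q m (R 8) ?M ?B"
    using I assms(2) r by (intro heap_repr_upd[of l q m "R 8" M B]) auto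
  have "valid_buckets l q a ?B"
    using I top by (intro valid_buckets_upd) auto
  moreover have "partial_sol l q a j w js" "w mod q = ?r"
    using valid_bucketsD[of l q a B w js j ?r] I top assms(2) by auto
  then have "partial_sol l q a (Suc j) ((w + v) div q) (js @ is)"
    using I q by (intro partial_sol_combine) auto
  moreover have "successively (\<lambda>x y. ?M (m + x) = y) (js @ is)"
  proof -
    have keep: "?M (m + x) = M (m + x)" if "x \<in> set (js @ is)" "x \<noteq> p" for x
    proof -
      have "x < m" using that inserting_leaf(1)[OF ins sub] inserting_leaf(2)[OF ins] by auto
      then show ?thesis using that(2) addr_neq_cell[of x "m + x" j ?r] by auto
    qed
    then have "?M (m + js ! k) = M (m + js ! k)" if "k < length js" "js ! k \<noteq> p" for k
      using that by simp
    \<comment> \<open>Distinctness places \<open>p\<close> only at the end of \<open>js\<close>. The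
      single overwritten successor cell thus joins \<open>js\<close> to \<open>is\<close> and breaks
      no link inside either list.\<close>
    moreover have "js ! k \<noteq> p" if "Suc k < length js" for k
      using that dist node(1) by (simp add: p_def last_conv_nth nth_eq_iff_index_eq)
    ultimately have js: "successively (\<lambda>x y. ?M (m + x) = y) js"
      using node(4) unfolding successively_conv_nth by (metis Suc_lessD)
    have "x \<noteq> p" if "x \<in> set is" for x using that dist p by auto
    then have "?M (m + x) = M (m + x)" if "x \<in> set is" for x using that keep by simp
    then have "successively (\<lambda>x y. ?M (m + x) = y) is"
      by (rule successively_update[OF chain])
    then show ?thesis
      using js node(1) by (simp add: successively_append_iff p_def)
  qed
  moreover have "(w + v) div q < q ^ l"
    using \<open>partial_sol l q a (Suc j) ((w + v) div q) (js @ is)\<close> by (simp add: partial_sol_def)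
  then have "bounded_state X (?R, ?M)"
  proof -
    have "M (3 * m + p) \<le> X" "hd js \<le> X" "hd is \<le> X"
      using inserting_bounded(3,4)[OF ins] node(3) by metis+
    moreover have "Suc j \<le> X" using assms(2) l_less_X by simp
    ultimately show ?thesis
      using I X pm addr_less[OF assms(2) r] \<open>(w + v) div q < q ^ l\<close> by (intro bounded_upd) auto
  qed
  ultimately have "inserting a i (Suc j) ((w + v) div q) (js @ is) ?B ?R ?M"
    using I assms(2) node(1) eq heap by (simp add: inserting_def)
  then show ?thesis using pm neq by (auto simp: sem bucket_addr_def)
qed

text \<open>Shared by the two ways an insertion ends, a push and the arrival at level
  \<open>l\<close>. The bound holds for arbitrary \<open>n\<close> because a push can happen with
  any number of levels left.\<close>

lemma insert_loop_stop:
  assumes ins: "inserting a i j v is B R M"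
    and step: "case sem insert_step (R, M) of (R', M') \<Rightarrow>
      inserted i B' R' M' \<and> (\<forall>k. i < k \<and> k < m \<longrightarrow> M' k = M k)"
  shows "\<exists>t\<le>(n + 1) * (2 * C) + C. \<exists>R' M'. exec (While active_reg insert_step) (R, M) t (R', M') \<and>
     inserted i B' R' M' \<and> (\<forall>k. i < k \<and> k < m \<longrightarrow> M' k = M k)"
proof -
  obtain R' M' where 1: "sem insert_step (R, M) = (R', M')" "inserted i B' R' M'"
    "\<forall>k. i < k \<and> k < m \<longrightarrow> M' k = M k"
    using step by (auto split: prod.splits)
  have "bounded_state X (R, M)" "bounded_state X (R', M')" and v: "R 7 = 1" "R' 7 = 0"
    using ins 1(2) by (auto simp: inserting_def inserted_def)
  then have c: "cost active_reg (R, M) \<le> C" "cost active_reg (R', M') \<le> C"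
    by (auto intro!: cost_test simp del: cost.simps simp: loop_tests_def)
  obtain t where t: "t \<le> C" "exec insert_step (R, M) t (R', M')"
    using exec_straight_line[OF _ \<open>bounded_state X (R, M)\<close>, of insert_step] 1(1) by (auto simp: straight_line_def)
  have "exec (While active_reg insert_step) (R', M') (cost active_reg (R', M')) (R', M')"
    using v by (intro exec.WhileFalse) simp
  then have "exec (While active_reg insert_step) (R, M) (cost active_reg (R, M) + t + cost active_reg (R', M')) (R', M')"
    using v t by (intro exec.WhileTrue) auto
  moreover have "cost active_reg (R, M) + t + cost active_reg (R', M') \<le> (n + 1) * (2 * C) + C"
    using c t(1) unfolding add_mult_distrib by linarith
  ultimately show ?thesis using 1 by blast
qed

lemma insert_loop:
  "inserting a i j v is B R M \<Longrightarrow> j + n = l \<Longrightarrow>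
   \<exists>t\<le>(n + 1) * (2 * C) + C. \<exists>R' M'. exec (While active_reg insert_step) (R, M) t (R', M') \<and>
     inserted i (insert_node q n j B v is) R' M' \<and> (\<forall>k. i < k \<and> k < m \<longrightarrow> M' k = M k)"
proof (induction n arbitrary: j v "is" B R M)
  case 0
  then show ?case using insert_loop_stop[OF 0(1) insert_step_finish[OF 0(1)], where n = 0] by simp
next
  case (Suc n)
  have j: "j < l" using Suc.prems(2) by simp
  show ?case
  proof (cases "B j ((q - v mod q) mod q)")
    case Nil
    show ?thesis by (rule insert_loop_stop[OF Suc.prems(1) insert_step_push[OF Suc.prems(1) j Nil]])
  next
    case (Cons u ns)
    obtain w js where u: "u = (w, js)" by force
    obtain R1 M1 where 1: "sem insert_step (R, M) = (R1, M1)"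
      "inserting a i (Suc j) ((w + v) div q) (js @ is) (upd B j ((q - v mod q) mod q) ns) R1 M1"
      "\<forall>k<m. M1 k = M k"
      using insert_step_pop[OF Suc.prems(1) j Cons[unfolded u]] by (auto split: prod.splits)
    obtain t2 R' M' where 2: "t2 \<le> (n + 1) * (2 * C) + C"
      "exec (While active_reg insert_step) (R1, M1) t2 (R', M')"
      "inserted i (insert_node q n (Suc j) (upd B j ((q - v mod q) mod q) ns) ((w + v) div q) (js @ is)) R' M'"
      "\<forall>k. i < k \<and> k < m \<longrightarrow> M' k = M1 k"
      using Suc.IH[OF 1(2)] Suc.prems(2) by auto
    have b: "bounded_state X (R, M)" and v: "R 7 = 1"
      using Suc.prems(1) by (auto simp: inserting_def)
    have c: "cost active_reg (R, M) \<le> C"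
      by (rule cost_test[OF _ b]) (simp add: loop_tests_def)
    obtain t where t: "t \<le> C" "exec insert_step (R, M) t (R1, M1)"
      using exec_straight_line[OF _ b, of insert_step] 1(1) by (auto simp: straight_line_def)
    have "exec (While active_reg insert_step) (R, M) (cost active_reg (R, M) + t + t2) (R', M')"
      using v t 2(2) by (intro exec.WhileTrue) auto
    moreover have "cost active_reg (R, M) + t + t2 \<le> (Suc n + 1) * (2 * C) + C"
      using c t(1) 2(1) by simp
    moreover have "inserted i (insert_node q (Suc n) j B v is) R' M'"
      using 2(3) Cons u by simp
    ultimately show ?thesis using 1(3) 2(4) by (metis (no_types, lifting))
  qed
qed

end

section \<open>The whole run\<close>

context ksum_ram
begin

definition loop_inv where
  "loop_inv a n = (\<lambda>(R, M). n \<le> m \<and> R 0 = l \<and> R 1 = q \<and> R 2 = m \<and> R 3 = m - n \<and>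
     heap_repr l q m (R 8) M (process l q a (m - n)) \<and> (\<forall>k. m - n \<le> k \<and> k < m \<longrightarrow> M k = a k) \<and>
     bounded_state X (R, M))"

lemma process_element_correct:
  assumes a: "\<And>k. k < m \<Longrightarrow> a k < q ^ l" and inv: "loop_inv a (Suc n) (R, M)"
  shows "\<exists>t\<le>(2 * l + 5) * C. \<exists>s'. exec process_element (R, M) t s' \<and> loop_inv a n s'"
proof -
  define i where "i = m - Suc n"
  have i: "i < m" "m - n = Suc i" and n: "n \<le> m" using inv by (auto simp: loop_inv_def i_def)
  have I: "R 0 = l" "R 1 = q" "R 2 = m" "R 3 = i" "heap_repr l q m (R 8) M (process l q a i)"
    "bounded_state X (R, M)" and M: "\<And>k. i \<le> k \<Longrightarrow> k < m \<Longrightarrow> M k = a k"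
    using inv by (auto simp: loop_inv_def i_def)
  let ?R = "R(5 := a i, 6 := i, 4 := 0, 7 := 1)"
  have "sem start_element (R, M) = (?R, M)"
    using I(4) M[of i] i(1) by (simp add: start_element_def)
  then obtain t1 where t1: "t1 \<le> C" "exec start_element (R, M) t1 (?R, M)"
    using exec_straight_line[OF _ I(6), of start_element] by (auto simp: straight_line_def)
  have "a i \<le> X" "i \<le> X" "0 \<le> X" "1 \<le> X"
    using a[OF i(1)] i(1) X m_pos by linarith+
  then have "bounded_state X (?R, M)" using I(6) by (intro bounded_upd)
  moreover have "leaves l q (process l q a i) + mset [i] = mset [0..<Suc i]"
    using q by (simp add: leaves_process)
  moreover have "valid_buckets l q a (process l q a i)"
    using a i(1) q by (intro valid_buckets_process) auto
  moreover have "partial_sol l q a 0 (a i) [i]" using a[OF i(1)] by (simp add: partial_sol_def)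
  ultimately have "inserting a i 0 (a i) [i] (process l q a i) ?R M"
    using I(1-5) i(1) unfolding inserting_def by simp
  from insert_loop[OF this, of l] obtain t2 R' M' where t2: "t2 \<le> (l + 1) * (2 * C) + C"
    "exec (While active_reg insert_step) (?R, M) t2 (R', M')"
    and ins: "inserted i (process l q a (Suc i)) R' M'"
    and M': "\<forall>k. i < k \<and> k < m \<longrightarrow> M' k = M k" by auto
  note J = ins[unfolded inserted_def]
  have bd: "bounded_state X (R', M')" using J by blast
  have "sem next_element (R', M') = (R'(3 := Suc i), M')"
    using J by (simp add: next_element_def)
  then obtain t3 where t3: "t3 \<le> C" "exec next_element (R', M') t3 (R'(3 := Suc i), M')"
    using exec_straight_line[OF _ bd, of next_element] by (auto simp: straight_line_def)
  have "exec process_element (R, M) (t1 + (t2 + t3)) (R'(3 := Suc i), M')"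
    unfolding process_element_def by (rule exec.Seq[OF t1(2) exec.Seq[OF t2(2) t3(2)]])
  moreover have "t1 + (t2 + t3) \<le> (2 * l + 5) * C"
    using t1(1) t2(1) t3(1) by (simp add: algebra_simps)
  moreover have "loop_inv a n (R'(3 := Suc i), M')"
  proof -
    have "Suc i \<le> X" using i(1) X(1) by linarith
    then have "bounded_state X (R'(3 := Suc i), M')" using J by (intro bounded_upd) auto
    then show ?thesis using J M M' i n unfolding loop_inv_def by auto
  qed
  ultimately show ?thesis by blast
qed

lemma exec_main_loop:
  assumes a: "\<And>k. k < m \<Longrightarrow> a k < q ^ l" and "loop_inv a m s"
  shows "\<exists>t\<le>m * (C + (2 * l + 5) * C) + C. \<exists>s'.
    exec (While (Op Sub m_reg i_reg) process_element) s t s' \<and> loop_inv a 0 s'"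
proof (rule exec_While_count[where Inv = "loop_inv a"])
  fix n s assume inv: "loop_inv a (Suc n) s"
  obtain R M where s: "s = (R, M)" by force
  show "val (Op Sub m_reg i_reg) s \<noteq> 0 \<and>
      (\<exists>t\<le>(2 * l + 5) * C. \<exists>s'. exec process_element s t s' \<and> loop_inv a n s')"
    using process_element_correct[OF a, where n = n and R = R and M = M] inv by (auto simp: s loop_inv_def)
next
  fix s assume "loop_inv a 0 s" then show "val (Op Sub m_reg i_reg) s = 0"
    by (auto simp: loop_inv_def)
next
  fix n s assume "loop_inv a n s"
  then have "bounded_state X s" by (auto simp: loop_inv_def)
  then show "cost (Op Sub m_reg i_reg) s \<le> C" by (intro cost_test) (simp add: loop_tests_def)
qed (rule assms(2))

section \<open>Output of the index list\<close>

lemma exec_double_loop: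
  assumes "R 0 = l" "R 2 = m" "R 4 = 0" "R 9 = c" "R 10 = 1" "bounded_state X (R, M)"
  shows "\<exists>t\<le>l * (C + C) + C. \<exists>R'. exec (While l_reg double_length) (R, M) t (R', M) \<and>
    R' 2 = m \<and> R' 4 = 0 \<and> R' 9 = c \<and> R' 10 = 2 ^ l \<and> bounded_state X (R', M)"
proof -
  define Inv :: "nat \<Rightarrow> state \<Rightarrow> bool" where "Inv n = (\<lambda>(R, M'). M' = M \<and> n \<le> l \<and> R 0 = n \<and> R 2 = m \<and> R 4 = 0 \<and> R 9 = c \<and>
    R 10 = 2 ^ (l - n) \<and> bounded_state X (R, M))" for n
  have "\<exists>t\<le>l * (C + C) + C. \<exists>s'. exec (While l_reg double_length) (R, M) t s' \<and> Inv 0 s'"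
  proof (rule exec_While_count[where Inv = Inv])
    fix n s assume "Inv (Suc n) s"
    then obtain R where s: "s = (R, M)" and I: "Suc n \<le> l" "R 0 = Suc n" "R 2 = m" "R 4 = 0" "R 9 = c"
      "R 10 = 2 ^ (l - Suc n)" "bounded_state X (R, M)"
      by (auto simp: Inv_def)
    have pow: "2 ^ (l - Suc n) + 2 ^ (l - Suc n) = (2::nat) ^ (l - n)"
      using I(1) by (simp add: Suc_diff_Suc flip: mult_2 power_Suc)
    let ?R = "R(10 := 2 ^ (l - n), 0 := n)"
    have "sem double_length (R, M) = (?R, M)" using I by (simp add: double_length_def pow)
    moreover have "(2::nat) ^ (l - n) \<le> 2 ^ l" by (intro power_increasing) auto
    then have "2 ^ (l - n) \<le> X" "n \<le> X" using m X(1) I(1) l_less_X by linarith+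
    then have "bounded_state X (?R, M)" using I(7) by (intro bounded_upd)
    ultimately have "Inv n (?R, M)" "sem double_length (R, M) = (?R, M)"
      using I by (simp_all add: Inv_def)
    then have "\<exists>t\<le>C. \<exists>s'. exec double_length s t s' \<and> Inv n s'"
      using exec_straight_line[OF _ I(7), of double_length] unfolding s straight_line_def
      by (metis insertCI)
    then show "val l_reg s \<noteq> 0 \<and> (\<exists>t\<le>C. \<exists>s'. exec double_length s t s' \<and> Inv n s')"
      using I(2) s by simp
  next
    fix n s assume "Inv n s"
    then have "bounded_state X s" by (auto simp: Inv_def)
    then show "cost l_reg s \<le> C" by (intro cost_test) (simp add: loop_tests_def)
  next
    show "Inv l (R, M)" using assms by (simp add: Inv_def)
  qed (auto simp: Inv_def)
  then obtain t s' where t: "t \<le> l * (C + C) + C" "exec (While l_reg double_length) (R, M) t s'" "Inv 0 s'"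
    by blast
  moreover obtain R' M' where "s' = (R', M')" by force
  ultimately show ?thesis by (intro exI[of _ t] conjI exI[of _ R']) (auto simp: Inv_def)
qed

text \<open>The output only overwrites cells below \<open>2 ^ l \<le> m\<close>, so the successor
  cells \<open>m + x\<close> keep guiding the walk. Nothing is assumed about the links, so the time
  bound also covers runs without a solution, which print meaningless indices.\<close>

lemma exec_emit_loop:
  assumes "R 2 = m" "R 4 = 0" "R 10 = 2 ^ l" "bounded_state X (R, M)"
  shows "\<exists>t\<le>2 ^ l * (C + C) + C. \<exists>R' M'. exec (While p_reg emit_index) (R, M) t (R', M') \<and>
    (\<forall>k<2 ^ l. M' k = ((\<lambda>x. M (m + x)) ^^ k) (R 9))"
proof -
  let ?f = "\<lambda>x. M (m + x)"
  define Inv :: "nat \<Rightarrow> state \<Rightarrow> bool" where "Inv n = (\<lambda>(R', M'). n \<le> 2 ^ l \<and> R' 2 = m \<and> R' 4 = 2 ^ l - n \<and> R' 10 = n \<and>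
    R' 9 = (?f ^^ (2 ^ l - n)) (R 9) \<and> (\<forall>k<2 ^ l - n. M' k = (?f ^^ k) (R 9)) \<and>
    (\<forall>x. M' (m + x) = M (m + x)) \<and> bounded_state X (R', M'))" for n
  have "\<exists>t\<le>2 ^ l * (C + C) + C. \<exists>s'. exec (While p_reg emit_index) (R, M) t s' \<and> Inv 0 s'"
  proof (rule exec_While_count[where Inv = Inv])
    fix n s assume "Inv (Suc n) s"
    then obtain R' M' where s: "s = (R', M')" and I: "Suc n \<le> 2 ^ l" "R' 2 = m" "R' 4 = 2 ^ l - Suc n"
      "R' 10 = Suc n" "R' 9 = (?f ^^ (2 ^ l - Suc n)) (R 9)" "bounded_state X (R', M')"
      and M': "\<And>k. k < 2 ^ l - Suc n \<Longrightarrow> M' k = (?f ^^ k) (R 9)" "\<And>x. M' (m + x) = M (m + x)"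
      by (auto simp: Inv_def)
    let ?j = "2 ^ l - Suc n"
    have j: "2 ^ l - n = Suc ?j" "?j < m" using I(1) m by linarith+
    let ?M = "M'(?j := R' 9)"
    let ?R = "R'(9 := ?f (R' 9), 4 := Suc ?j, 10 := n)"
    have M: "?M (m + x) = M (m + x)" for x using j M'(2) by simp
    have "m + R' 9 \<noteq> ?j" using j by simp
    then have sem: "sem emit_index (R', M') = (?R, ?M)"
      using I(2-4) M'(2)[of "R' 9"] by (simp add: emit_index_def array_def)
    have "Suc ?j \<le> X" "n \<le> X" using I(1) m j X(1) by linarith+
    moreover have "R' 9 \<le> X" "?f (R' 9) \<le> X"
      using I(6) M'(2)[of "R' 9"] by (simp_all add: bounded_state_def) metis
    ultimately have "bounded_state X (?R, ?M)"
      using I(6) by (intro bounded_upd)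
    then have "Inv n (?R, ?M)"
      using I j M M'(1) by (auto simp: Inv_def less_Suc_eq)
    then have "\<exists>t\<le>C. \<exists>s'. exec emit_index s t s' \<and> Inv n s'"
      using exec_straight_line[OF _ I(6), of emit_index] sem unfolding s straight_line_def
      by (metis insertCI)
    then show "val p_reg s \<noteq> 0 \<and> (\<exists>t\<le>C. \<exists>s'. exec emit_index s t s' \<and> Inv n s')"
      using I(4) s by simp
  next
    fix n s assume "Inv n s"
    then have "bounded_state X s" by (auto simp: Inv_def)
    then show "cost p_reg s \<le> C" by (intro cost_test) (simp add: loop_tests_def)
  next
    show "Inv (2 ^ l) (R, M)" using assms by (simp add: Inv_def)
  qed (auto simp: Inv_def)
  then obtain t s' where t: "t \<le> 2 ^ l * (C + C) + C" "exec (While p_reg emit_index) (R, M) t s'" "Inv 0 s'"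
    by blast
  moreover obtain R' M' where "s' = (R', M')" by force
  ultimately show ?thesis
    by (intro exI[of _ t] conjI exI[of _ R'] exI[of _ M']) (auto simp: Inv_def)
qed

lemma node_repr_walk:
  assumes "node_repr m M (v, is)" "k < length is"
  shows "((\<lambda>x. M (m + x)) ^^ k) (M (2 * m + last is)) = is ! k"
  using assms(2)
proof (induction k)
  case 0
  then show ?case using assms(1) by (simp add: node_repr_def hd_conv_nth)
next
  case (Suc k)
  have "successively (\<lambda>x y. M (m + x) = y) is" using assms(1) by (simp add: node_repr_def)
  then show ?case using Suc by (simp add: successively_conv_nth)
qed

lemma exec_ksum_prog:
  assumes "a \<in> ksum_instances m (q ^ l)"
  shows "\<exists>t\<le>m * (4 * l + 12) * C. \<exists>s. exec ksum_prog (input_state [l, q, m] a) t s \<and>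
    (\<forall>v is ns. process l q a m l 0 = (v, is) # ns \<longrightarrow> (\<forall>k<2 ^ l. k < length is \<longrightarrow> snd s k = is ! k))"
proof -
  let ?s = "input_state [l, q, m] a"
  have a: "a k < q ^ l" if "k < m" for k
    using assms that by (auto simp: ksum_instances_def PiE_dflt_def)
  have a0: "a k = 0" if "m \<le> k" for k
    using assms that by (auto simp: ksum_instances_def PiE_dflt_def)
  have "a k \<le> X" for k using a[of k] a0[of k] X(2) by (cases "k < m") auto
  moreover have "q \<le> X"
  proof -
    have "1 * q \<le> l * q" using l by (intro mult_right_mono) auto
    then show ?thesis using X(1) by linarith
  qed
  moreover have "m \<le> X" using X(1) by linarith
  ultimately have "bounded_state X ?s"
    using l_less_X by (auto simp: bounded_state_def input_state_def less_Suc_eq numeral_3_eq_3)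
  \<comment> \<open>The bucket tops lie beyond the input, where an instance is zero, and zero
    encodes an empty stack: the initial memory already represents empty buckets.\<close>
  moreover have "a (addr j r) = 0" for j r by (rule a0) (simp add: bucket_addr_def)
  then have "heap_repr l q m 0 a (process l q a 0)" by (simp add: heap_repr_def)
  ultimately have "loop_inv a m ?s"
    by (auto simp: loop_inv_def input_state_def numeral_2_eq_2)
  from exec_main_loop[OF a this] obtain t1 R1 M1 where
    t1: "t1 \<le> m * (C + (2 * l + 5) * C) + C"
      "exec (While (Op Sub m_reg i_reg) process_element) ?s t1 (R1, M1)"
    and I: "R1 0 = l" "R1 2 = m" "heap_repr l q m (R1 8) M1 (process l q a m)" "bounded_state X (R1, M1)"
    by (fastforce simp: loop_inv_def)
  let ?R2 = "R1(9 := M1 (2 * m + R1 8), 10 := 1, 4 := 0)"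
  have "sem start_output (R1, M1) = (?R2, M1)"
    using I by (simp add: start_output_def array_def)
  then obtain t2 where t2: "t2 \<le> C" "exec start_output (R1, M1) t2 (?R2, M1)"
    using exec_straight_line[OF _ I(4), of start_output] by (auto simp: straight_line_def)
  have "M1 (2 * m + R1 8) \<le> X" "1 \<le> X" "0 \<le> X"
    using I(4) l_less_X by (auto simp: bounded_state_def)
  then have "bounded_state X (?R2, M1)" using I(4) by (intro bounded_upd)
  from exec_double_loop[OF _ _ _ _ _ this] I(1,2) obtain t3 R3 where
    t3: "t3 \<le> l * (C + C) + C" "exec (While l_reg double_length) (?R2, M1) t3 (R3, M1)"
    and J: "R3 2 = m" "R3 4 = 0" "R3 9 = M1 (2 * m + R1 8)" "R3 10 = 2 ^ l" "bounded_state X (R3, M1)"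
    by auto
  from exec_emit_loop[OF J(1,2,4,5)] obtain t4 R4 M4 where
    t4: "t4 \<le> 2 ^ l * (C + C) + C" "exec (While p_reg emit_index) (R3, M1) t4 (R4, M4)"
    and out: "\<And>k. k < 2 ^ l \<Longrightarrow> M4 k = ((\<lambda>x. M1 (m + x)) ^^ k) (R3 9)" by blast
  have "exec ksum_prog ?s (t1 + (t2 + (t3 + t4))) (R4, M4)"
    unfolding ksum_prog_def by (rule exec.Seq[OF t1(2) exec.Seq[OF t2(2) exec.Seq[OF t3(2) t4(2)]]])
  moreover have "t1 + (t2 + (t3 + t4)) \<le> m * (4 * l + 12) * C"
  proof -
    have "t1 + (t2 + (t3 + t4)) \<le> (m * (2 * l + 6) + (2 * l + 4) + 2 * 2 ^ l) * C"
      using t1(1) t2(1) t3(1) t4(1) by (simp add: algebra_simps)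
    \<comment> \<open>Both phases after the main loop are charged to \<open>m\<close>, using
      \<open>1 \<le> m\<close> and \<open>2 ^ l \<le> m\<close>.\<close>
    also have "\<dots> \<le> (m * (2 * l + 6) + m * (2 * l + 4) + 2 * m) * C"
      using m m_pos by (intro mult_right_mono add_mono) auto
    also have "\<dots> = m * (4 * l + 12) * C" by (simp add: algebra_simps)
    finally show ?thesis .
  qed
  moreover have "M4 k = is ! k" if "process l q a m l 0 = (v, is) # ns" "k < 2 ^ l" "k < length is" for v "is" ns k
  proof -
    have "node_repr m M1 (v, is)" "R1 8 = last is" using I(3) that(1) by (auto simp: heap_repr_def)
    then show ?thesis using out[OF that(2)] node_repr_walk[of M1 v "is" k] that(3) J(3) by simp
  qed
  ultimately show ?thesis by (metis snd_conv)
qed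

end

text \<open>Distinctness and range of the indices need no separate invariant: the list is a
  sub-multiset of \<open>mset [0..<m]\<close>.\<close>

lemma ksum_solution_process:
  assumes "2 \<le> q" "a \<in> ksum_instances m (q ^ l)" "process l q a m l 0 = (v, is) # ns"
  shows "ksum_solution (2 ^ l) (q ^ l) m a is"
proof -
  let ?B = "process l q a m"
  have "valid_buckets l q a ?B"
    using assms(1,2) by (intro valid_buckets_process) (auto simp: ksum_instances_def PiE_dflt_def)
  then have sol: "partial_sol l q a l v is"
    using valid_bucketsD(1)[of l q a ?B v "is" l 0] assms(3) by simp
  have "mset is \<subseteq># leaves l q ?B"
    using in_leaves[of l l 0 q v "is" ?B] assms(1,3) by simp
  then have "mset is \<subseteq># mset [0..<m]" using assms(1) by (simp add: leaves_process)
  then obtain ys where "mset (is @ ys) = mset [0..<m]"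
    by (metis ex_mset mset_append subset_mset.less_eqE)
  then have "distinct (is @ ys)" "set (is @ ys) = set [0..<m]"
    by (metis distinct_upt mset_eq_imp_distinct_iff, metis mset_eq_setD)
  moreover have "sum_list (map a is) mod q ^ l = 0"
    using sol unfolding partial_sol_def by (metis mod_mult_self2_is_0)
  ultimately show ?thesis using sol
    by (auto simp: ksum_solution_def partial_sol_def cong_def simp flip: atLeast0LessThan)
qed

section \<open>Asymptotic bounds\<close>

lemma set_pmf_ksum_dist: "0 < Q \<Longrightarrow> set_pmf (ksum_dist m Q) = ksum_instances m Q"
  unfolding ksum_dist_def ksum_instances_def
  by (subst set_Pi_pmf) (auto simp: PiE_dflt_def set_pmf_of_set lessThan_empty_iff)

text \<open>8 is the least value of \<open>2 ^ l * q ^ 2\<close>. From there on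
  \<open>ln x \<ge> 1\<close> absorbs the additive 1, and \<open>1 / ln 2 \<le> 2\<close> the change
  of base.\<close>

lemma len_le_ln: "8 \<le> x \<Longrightarrow> real (len x) \<le> 3 * ln (real x)"
proof -
  assume x: "8 \<le> x"
  have ln2: "1 / 2 \<le> ln (2::real)" using ln2_ge_two_thirds by simp
  have "ln (8::real) \<le> ln x" using x by simp
  moreover have "ln (8::real) = 3 * ln 2" using ln_realpow[of 2 3] by simp
  ultimately have "1 \<le> ln (real x)" using ln2 by linarith
  moreover have "log 2 (real x) \<le> 2 * ln (real x)"
  proof -
    have "ln (real x) \<le> 2 * ln (real x) * ln 2"
      using ln2 \<open>1 \<le> ln (real x)\<close> mult_left_mono[of "1/2" "ln 2" "2 * ln (real x)"] by simp
    then show ?thesis using ln2 by (simp add: log_def divide_le_eq)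
  qed
  moreover have "real (len x) \<le> 1 + log 2 (real x)"
  proof -
    have "2 ^ (len x - 1) \<le> x"
      using x floorlog_bounds[of x 2] by (simp add: len_def max_def split: if_splits)
    then have "real (len x - 1) \<le> log 2 (real x)"
      using x by (simp add: le_log2_of_power)
    then show ?thesis using len_ge_1[of x] by simp
  qed
  ultimately show ?thesis by linarith
qed

definition address_bound :: "nat \<Rightarrow> nat \<Rightarrow> nat" where
  "address_bound l q = 5 * num_elements l q + l * q + q ^ l"

definition time_bound :: "nat \<Rightarrow> nat \<Rightarrow> nat \<Rightarrow> nat" where
  "time_bound K l q = num_elements l q * (4 * l + 12) * (K * (len (address_bound l q))\<^sup>2)"

context
  fixes l q :: nat and g :: nat
  assumes l: "1 \<le> l" and q: "2 \<le> q" and g: "g = 2 ^ l * q ^ 2"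
begin

lemma g_ge: "8 \<le> g"
proof -
  have "(2::nat) ^ 1 \<le> 2 ^ l" using l by (intro power_increasing) auto
  moreover have "2 ^ 2 \<le> q ^ 2" using q by (intro power_mono) auto
  ultimately have "2 ^ 1 * 2 ^ 2 \<le> g" unfolding g by (intro mult_le_mono)
  then show ?thesis by simp
qed

lemma ln_g_ge: "1 \<le> ln (real g)" "real l \<le> 2 * ln (real g)"
proof -
  have ln2: "1 / 2 \<le> ln (2::real)" using ln2_ge_two_thirds by simp
  have "ln (8::real) \<le> ln g" using g_ge by simp
  moreover have "ln (8::real) = 3 * ln 2" using ln_realpow[of 2 3] by simp
  ultimately show "1 \<le> ln (real g)" using ln2 by linarith
  have "2 ^ l * 1 \<le> g" unfolding g using q by (intro mult_le_mono) auto
  then have "real (2 ^ l) \<le> real g" by (simp only: of_nat_le_iff mult_1_right)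
  then have "ln (2 ^ l) \<le> ln (real g)" using g_ge by simp
  then have "real l * ln 2 \<le> ln (real g)" by (simp add: ln_realpow)
  moreover have "real l * (1 / 2) \<le> real l * ln 2" using ln2 by (intro mult_left_mono) auto
  ultimately show "real l \<le> 2 * ln (real g)" by linarith
qed

lemma num_elements_eq: "num_elements l q = 2 * l * g"
  by (simp add: num_elements_def g power2_eq_square)

lemma num_elements_le: "real (num_elements l q) \<le> 4 * (real g * ln (real g))"
proof -
  have "real l * real g \<le> 2 * ln (real g) * real g"
    using ln_g_ge(2) by (intro mult_right_mono) auto
  then show ?thesis by (simp add: num_elements_eq mult_ac)
qed

text \<open>\<open>q ^ l\<close> is not polynomial in \<open>g\<close>, but only the length of the
  bound enters the time. The exponent \<open>l\<close> is itself logarithmic in \<open>g\<close>, so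
  the length is of order \<open>ln g\<close> squared.\<close>

lemma address_bound_le: "address_bound l q \<le> g ^ (l + 4)"
proof -
  have "l \<le> 2 ^ l" by (simp add: less_imp_le)
  also have "2 ^ l * 1 \<le> g" unfolding g using q by (intro mult_le_mono) auto
  finally have lg: "l \<le> g" by simp
  have "q * 1 \<le> q ^ 2" using q by (simp add: power2_eq_square)
  also have "1 * q ^ 2 \<le> g" unfolding g by (intro mult_le_mono) auto
  finally have qg: "q \<le> g" by simp
  have "5 * num_elements l q = 10 * (l * g)" by (simp add: num_elements_eq)
  also have "\<dots> \<le> 10 * (g * g)" using lg by (intro mult_le_mono) auto
  finally have "5 * num_elements l q \<le> 10 * g ^ 2" by (simp add: power2_eq_square)
  moreover have "l * q \<le> g ^ 2" using lg qg by (simp add: power2_eq_square mult_le_mono)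
  moreover have "q ^ l \<le> g ^ l" using qg by (intro power_mono) auto
  ultimately have "address_bound l q \<le> 11 * g ^ 2 + g ^ l" by (simp add: address_bound_def)
  also have "\<dots> \<le> 11 * g ^ (l + 2) + g ^ (l + 2)"
    using g_ge by (intro add_mono mult_left_mono power_increasing) auto
  also have "\<dots> \<le> g ^ 2 * g ^ (l + 2)"
  proof -
    have "8 ^ 2 \<le> g ^ 2" using g_ge by (intro power_mono) auto
    then have "12 \<le> g ^ 2" by simp
    then have "12 * g ^ (l + 2) \<le> g ^ 2 * g ^ (l + 2)" by (intro mult_right_mono) auto
    then show ?thesis by simp
  qed
  also have "\<dots> = g ^ (2 + (l + 2))" by (rule power_add[symmetric])
  also have "2 + (l + 2) = l + 4" by simp
  finally show ?thesis .
qed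

lemma time_bound_le: "real (time_bound K l q) \<le> real K * 25920 * (real g * ln (real g) ^ 6)"
proof -
  let ?L = "ln (real g)"
  have "len (address_bound l q) \<le> (l + 4) * len g"
    using len_mono[OF address_bound_le] len_power[of "l + 4" g] by simp
  then have "real (len (address_bound l q)) \<le> real (l + 4) * real (len g)"
    by (metis of_nat_le_iff of_nat_mult)
  also have "\<dots> \<le> (6 * ?L) * (3 * ?L)"
    using ln_g_ge len_le_ln[OF g_ge] by (intro mult_mono) auto
  finally have len: "real (len (address_bound l q)) \<le> 18 * ?L ^ 2"
    by (simp add: power2_eq_square)
  have "real (time_bound K l q) =
      real (num_elements l q) * real (4 * l + 12) * (real K * real (len (address_bound l q)) ^ 2)"
    by (simp only: time_bound_def of_nat_mult of_nat_power)
  \<comment> \<open>With L = ln g the three factors are at most \<open>4 * g * L\<close>,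
    \<open>20 * L\<close> (from \<open>4 * l + 12\<close>) and
    \<open>K * (18 * L\<^sup>2)\<^sup>2\<close>; hence the constant 25920 and the sixth
    power.\<close>
  also have "\<dots> \<le> 4 * (real g * ?L) * (20 * ?L) * (real K * (18 * ?L ^ 2) ^ 2)"
    using ln_g_ge by (intro mult_mono power_mono num_elements_le len mult_nonneg_nonneg) auto
  also have "\<dots> = real K * 25920 * (real g * ?L ^ 6)"
    by (simp add: power_mult_distrib power2_eq_square eval_nat_numeral)
  finally show ?thesis .
qed

lemma num_elements_ge: "real g \<le> real (num_elements l q)"
proof -
  have "1 * g \<le> (2 * l) * g" using l by (intro mult_le_mono) auto
  then show ?thesis by (simp add: num_elements_eq flip: of_nat_mult)
qed

end

lemma ksum_ram_instance:
  assumes K: "\<forall>X\<ge>2. \<forall>s. bounded_state X s \<longrightarrow>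
      (\<forall>P\<in>straight_line. \<exists>t\<le>K * (len X)\<^sup>2. exec P s t (sem P s)) \<and>
      (\<forall>e\<in>loop_tests. cost e s \<le> K * (len X)\<^sup>2)"
    and "1 \<le> l" "2 \<le> q"
  shows "ksum_ram l q (num_elements l q) (address_bound l q) (K * (len (address_bound l q))\<^sup>2)"
proof
  have "2 ^ l * 1 * 1 \<le> 2 ^ l * q * (2 * q * l)" using assms by (intro mult_le_mono) auto
  then show "2 ^ l \<le> num_elements l q" by (simp add: num_elements_def)
  have "2 ^ 1 \<le> (2::nat) ^ l" using assms by (intro power_increasing) auto
  with \<open>2 ^ l \<le> num_elements l q\<close> have X: "2 \<le> address_bound l q" by (simp add: address_bound_def)
  show "\<exists>t\<le>K * (len (address_bound l q))\<^sup>2. exec P s t (sem P s)"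
    if "P \<in> straight_line" "bounded_state (address_bound l q) s" for P s
    using K X that by blast
  show "cost e s \<le> K * (len (address_bound l q))\<^sup>2"
    if "e \<in> loop_tests" "bounded_state (address_bound l q) s" for e s
    using K X that by blast
qed (use assms in \<open>auto simp: address_bound_def\<close>)

theorem theorem4p1:
  "\<exists>(P :: prog) (m :: nat \<times> nat \<Rightarrow> nat) (T :: nat \<times> nat \<Rightarrow> nat) (p :: real).
    (\<lambda>x. real (m x)) \<in> soft_bigtheta {(l, q). l \<ge> 1 \<and> q \<ge> 2} (\<lambda>(l, q). 2 ^ l * real q ^ 2) \<and>
    (\<lambda>x. real (T x)) \<in> soft_bigo {(l, q). l \<ge> 1 \<and> q \<ge> 2} (\<lambda>(l, q). 2 ^ l * real q ^ 2) \<and>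
    p > 0 \<and>
    (\<forall>l \<ge> 1. \<forall>q \<ge> 2.
       ksum_time_bound P [l, q, m (l, q)] (q ^ l) (m (l, q)) (T (l, q)) \<and>
       ksum_success_prob P [l, q, m (l, q)] (2 ^ l) (q ^ l) (m (l, q)) \<ge> p)"
proof -
  obtain K where K: "\<forall>X\<ge>2. \<forall>s. bounded_state X s \<longrightarrow>
      (\<forall>P\<in>straight_line. \<exists>t\<le>K * (len X)\<^sup>2. exec P s t (sem P s)) \<and>
      (\<forall>e\<in>loop_tests. cost e s \<le> K * (len X)\<^sup>2)"
    using straight_line_cost by blast
  define m where "m = (\<lambda>(l, q). num_elements l q)"
  define T where "T = (\<lambda>(l, q). time_bound K l q)"
  let ?S = "{(l, q). l \<ge> 1 \<and> q \<ge> (2::nat)} :: (nat \<times> nat) set"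
  let ?g = "\<lambda>(l, q). 2 ^ l * real q ^ 2"
  have g: "?g (l, q) = real (2 ^ l * q ^ 2)" for l q by simp
  have nonneg: "0 \<le> real n * ln (real n) ^ c" for n c :: nat
    by (cases "n = 0") auto
  have "(\<lambda>x. real (m x)) \<in> O[principal ?S](\<lambda>x. ?g x * ln (?g x) ^ 1)"
  proof (rule landau_o.bigI[of 4])
    show "\<forall>\<^sub>F x in principal ?S. norm (real (m x)) \<le> 4 * norm (?g x * ln (?g x) ^ 1)"
      unfolding eventually_principal
    proof clarify
      fix l q :: nat assume "1 \<le> l" "2 \<le> q"
      from num_elements_le[OF this refl]
      show "norm (real (m (l, q))) \<le> 4 * norm (2 ^ l * (real q)\<^sup>2 * ln (2 ^ l * (real q)\<^sup>2) ^ 1)"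
        by (simp add: m_def abs_le_iff order.trans[OF _ abs_ge_self])
    qed
  qed simp
  then have "(\<lambda>x. real (m x)) \<in> soft_bigo ?S ?g" unfolding soft_bigo_def by blast
  moreover have "(\<lambda>x. real (m x)) \<in> \<Omega>[principal ?S](\<lambda>x. ?g x / ln (?g x) ^ 0)"
  proof (rule landau_omega.bigI[of 1])
    show "\<forall>\<^sub>F x in principal ?S. norm (real (m x)) \<ge> 1 * norm (?g x / ln (?g x) ^ 0)"
      unfolding eventually_principal
    proof clarify
      fix l q :: nat assume "1 \<le> l" "2 \<le> q"
      from num_elements_ge[OF this refl]
      show "1 * norm (2 ^ l * (real q)\<^sup>2 / ln (2 ^ l * (real q)\<^sup>2) ^ 0) \<le> norm (real (m (l, q)))"
        by (simp add: m_def)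
    qed
  qed simp
  then have "(\<lambda>x. real (m x)) \<in> soft_bigomega ?S ?g" unfolding soft_bigomega_def by blast
  ultimately have m: "(\<lambda>x. real (m x)) \<in> soft_bigtheta ?S ?g" by (simp add: soft_bigtheta_def)
  have "(\<lambda>x. real (T x)) \<in> O[principal ?S](\<lambda>x. ?g x * ln (?g x) ^ 6)"
  \<comment> \<open>A Landau constant has to be positive, while \<open>K\<close> could be 0.\<close>
  proof (rule landau_o.bigI[of "real (K + 1) * 25920"])
    show "\<forall>\<^sub>F x in principal ?S. norm (real (T x)) \<le> real (K + 1) * 25920 * norm (?g x * ln (?g x) ^ 6)"
      unfolding eventually_principal
    proof clarify
      fix l q :: nat assume lq: "1 \<le> l" "2 \<le> q"
      let ?G = "2 ^ l * q ^ 2"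
      have "real (time_bound K l q) \<le> real K * 25920 * (real ?G * ln (real ?G) ^ 6)"
        by (rule time_bound_le[OF lq refl])
      also have "\<dots> \<le> real (K + 1) * 25920 * (real ?G * ln (real ?G) ^ 6)"
        by (intro mult_right_mono nonneg) auto
      finally show "norm (real (T (l, q))) \<le>
          real (K + 1) * 25920 * norm (2 ^ l * (real q)\<^sup>2 * ln (2 ^ l * (real q)\<^sup>2) ^ 6)"
        by (simp add: T_def)
    qed
  qed simp
  then have T: "(\<lambda>x. real (T x)) \<in> soft_bigo ?S ?g" unfolding soft_bigo_def by blast
  have "ksum_time_bound ksum_prog [l, q, m (l, q)] (q ^ l) (m (l, q)) (T (l, q)) \<and>
      ksum_success_prob ksum_prog [l, q, m (l, q)] (2 ^ l) (q ^ l) (m (l, q)) \<ge> 3 / 4"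
    if lq: "1 \<le> l" "2 \<le> q" for l q
  proof
    let ?m = "num_elements l q"
    interpret ksum_ram l q ?m "address_bound l q" "K * (len (address_bound l q))\<^sup>2"
      by (rule ksum_ram_instance[OF K lq])
    show "ksum_time_bound ksum_prog [l, q, m (l, q)] (q ^ l) (m (l, q)) (T (l, q))"
      unfolding ksum_time_bound_def m_def T_def time_bound_def prod.case
    proof
      fix a assume "a \<in> ksum_instances ?m (q ^ l)"
      from exec_ksum_prog[OF this]
      show "\<exists>t s. exec ksum_prog (input_state [l, q, ?m] a) t s \<and>
          t \<le> ?m * (4 * l + 12) * (K * (len (address_bound l q))\<^sup>2)" by blast
    qed
    let ?D = "ksum_dist ?m (q ^ l)"
    let ?A = "{a. \<exists>t s. exec ksum_prog (input_state [l, q, ?m] a) t s \<and>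
        ksum_solution (2 ^ l) (q ^ l) ?m a (ram_output (2 ^ l) s)}"
    have "a \<in> ?A" if ne: "process l q a ?m l 0 \<noteq> []" and inst: "a \<in> ksum_instances ?m (q ^ l)" for a
    proof -
      obtain v "is" ns where p: "process l q a ?m l 0 = (v, is) # ns"
        using ne by (cases "process l q a ?m l 0") auto
      have sol: "ksum_solution (2 ^ l) (q ^ l) ?m a is"
        by (rule ksum_solution_process[OF lq(2) inst p])
      obtain t s where ex: "exec ksum_prog (input_state [l, q, ?m] a) t s"
        and out: "\<forall>k<2 ^ l. k < length is \<longrightarrow> snd s k = is ! k"
        using exec_ksum_prog[OF inst] p by blast
      have "length is = 2 ^ l" using sol by (simp add: ksum_solution_def)
      then have "ram_output (2 ^ l) s = is"
        using out by (intro nth_equalityI) (simp_all add: ram_output_def)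
      then show ?thesis using sol ex by blast
    qed
    \<comment> \<open>A nonempty top level yields a solution only for genuine instances, so the
      event is first restricted to the support.\<close>
    then have "{a. process l q a ?m l 0 \<noteq> []} \<inter> set_pmf ?D \<subseteq> ?A"
      using lq by (auto simp: set_pmf_ksum_dist)
    then have "measure_pmf.prob ?D ({a. process l q a ?m l 0 \<noteq> []} \<inter> set_pmf ?D) \<le> measure_pmf.prob ?D ?A"
      by (intro measure_pmf.finite_measure_mono) auto
    then show "ksum_success_prob ksum_prog [l, q, m (l, q)] (2 ^ l) (q ^ l) (m (l, q)) \<ge> 3 / 4"
      using prob_solved[OF lq refl] unfolding ksum_success_prob_def m_def
      by (simp add: measure_Int_set_pmf)
  qed
  then have "\<forall>l\<ge>1. \<forall>q\<ge>2.
      ksum_time_bound ksum_prog [l, q, m (l, q)] (q ^ l) (m (l, q)) (T (l, q)) \<and>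
      ksum_success_prob ksum_prog [l, q, m (l, q)] (2 ^ l) (q ^ l) (m (l, q)) \<ge> 3 / 4"
    by blast
  then show ?thesis
    by (intro exI[of _ ksum_prog] exI[of _ m] exI[of _ T] exI[of _ "3 / 4"] conjI m T) simp_all
qed

end
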